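(* For $i=1,2$, let $H_i$ be a complex Hilbert space and let $\mathcal{S}(H_i)$ be the Jordan algebra of all bounded self-adjoint operators on $H_i$. Let $k\ge 2$ be an integer, let $(i_1,\dots,i_m)$ be a finite sequence with $\{i_1,\dots,i_m\}=\{1,\dots,k\}$ such that there is an index $p$ with $i_p\neq i_q$ for all $q\neq p$, and let $$T_1\circ\cdots\circ T_k = T_{i_1}\cdots T_{i_m}+T_{i_m}\cdots T_{i_1}$$ be the associated generalized Jordan product. Suppose a map $\Phi:\mathcal{S}(H_1)\to\mathcal{S}(H_2)$ (not assumed linear, additive or continuous) satisfies $$\sigma(\Phi(A_1)\circ\Phi(A_2)\circ\cdots\circ\Phi(A_k))=\sigma(A_1\circ A_2\circ\cdots\circ A_k)$$ whenever $A_1,\dots,A_k\in\mathcal{S}(H_1)$ and at least one of the $A_i$'s has rank at most one. Suppose further that the range of $\Phi$ contains all self-adjoint operators on $H_2$ of rank at most $3$. Then there exist a scalar $\xi\in\{-1,1\}$ with $\xi^m=1$ and a unitary operator $U:H_1\to H_2$ such that either $$\Phi(A)=\xi UAU^*\quad\text{for all }A\in\mathcal{S}(H_1),$$ or $$\Phi(A)=\xi UA^tU^*\quad\text{for all }A\in\mathcal{S}(H_1),$$ where $A^t$ is the transpose of $A$ with respect to an arbitrary but fixed orthonormal basis of $H_1$.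
   Context: $\sigma(A)$ denotes the spectrum of the operator $A$. For a fixed orthonormal basis $\{e_j\}$ of $H_1$, the transpose $A^t$ is the bounded operator whose matrix with respect to $\{e_j\}$ is the transpose of the matrix of $A$; equivalently $A^t=JA^*J$ where $J:\sum_j\xi_je_j\mapsto\sum_j\overline{\xi_j}e_j$. *)

theory Defs
  imports "HOL-Analysis.Analysis"
begin

text \<open>
  A complex Hilbert space is rendered as a complete real inner product space with a compatible
  complex structure: the complex inner product is linear in the first argument and its real part
  is the library's real inner product. Hence \<open>\<langle>x, x\<rangle>\<close> is real and equals the
  squared library norm, so the topology and completeness are those of the complex inner product.
\<close>

class chilbert_space = real_inner + complete_space +
  fixes scaleC :: "complex \<Rightarrow> 'a \<Rightarrow> 'a" (infixr "*\<^sub>C" 75)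
    and cinner :: "'a \<Rightarrow> 'a \<Rightarrow> complex"
  assumes scaleC_add_right: "c *\<^sub>C (x + y) = c *\<^sub>C x + c *\<^sub>C y"
    and scaleC_add_left: "(c + d) *\<^sub>C x = c *\<^sub>C x + d *\<^sub>C x"
    and scaleC_scaleC: "c *\<^sub>C d *\<^sub>C x = (c * d) *\<^sub>C x"
    and scaleC_of_real: "complex_of_real r *\<^sub>C x = r *\<^sub>R x"
    and cinner_add_left: "cinner (x + y) z = cinner x z + cinner y z"
    and cinner_scaleC_left: "cinner (c *\<^sub>C x) y = c * cinner x y"
    and cinner_commute: "cinner x y = cnj (cinner y x)"
    and Re_cinner: "Re (cinner x y) = x \<bullet> y"

lemma scaleC_one: "1 *\<^sub>C x = (x :: 'a :: chilbert_space)"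
  using scaleC_of_real[of 1 x] by simp

global_interpretation cvec: vector_space "scaleC :: complex \<Rightarrow> 'a \<Rightarrow> 'a :: chilbert_space"
  by unfold_locales
    (simp_all add: scaleC_add_right scaleC_add_left scaleC_scaleC scaleC_one)

lemma cinner_self: "cinner x x = complex_of_real ((norm x)\<^sup>2)" for x :: "'a :: chilbert_space"
proof -
  have "Im (cinner x x) = 0"
    using arg_cong[OF cinner_commute[of x x], of Im] by simp
  then show ?thesis
    by (simp add: complex_eq_iff Re_cinner power2_norm_eq_inner)
qed

instantiation complex :: chilbert_space
begin
definition scaleC_complex :: "complex \<Rightarrow> complex \<Rightarrow> complex" where
  "scaleC_complex c x = c * x"
definition cinner_complex :: "complex \<Rightarrow> complex \<Rightarrow> complex" where
  "cinner_complex x y = x * cnj y"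
instance
  by standard
    (simp_all add: scaleC_complex_def cinner_complex_def inner_complex_def scaleR_conv_of_real
      algebra_simps)
end

definition bounded_clinear ::
    "('a :: chilbert_space \<Rightarrow> 'b :: chilbert_space) \<Rightarrow> bool" where
  "bounded_clinear T \<longleftrightarrow> bounded_linear T \<and> (\<forall>c x. T (c *\<^sub>C x) = c *\<^sub>C T x)"

definition is_cadjoint ::
    "('a :: chilbert_space \<Rightarrow> 'b :: chilbert_space) \<Rightarrow> ('b \<Rightarrow> 'a) \<Rightarrow> bool" where
  "is_cadjoint T S \<longleftrightarrow> (\<forall>x y. cinner (T x) y = cinner x (S y))"

definition cadjoint ::
    "('a :: chilbert_space \<Rightarrow> 'b :: chilbert_space) \<Rightarrow> 'b \<Rightarrow> 'a" where
  "cadjoint T = (THE S. is_cadjoint T S)"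

lemma cadjoint_eqI:
  assumes "is_cadjoint T S"
  shows "cadjoint T = S"
  unfolding cadjoint_def
proof (rule the_equality)
  fix R assume R: "is_cadjoint T R"
  have "R y = S y" for y
  proof -
    have "x \<bullet> R y = x \<bullet> S y" for x
      using assms R by (metis is_cadjoint_def Re_cinner)
    then show ?thesis
      by (metis inner_diff_right inner_eq_zero_iff right_minus_eq)
  qed
  then show "R = S" by blast
qed (fact assms)

definition selfadjoint_ops :: "('a :: chilbert_space \<Rightarrow> 'a) set" where
  "selfadjoint_ops = {A. bounded_clinear A \<and> is_cadjoint A A}"

definition unitary :: "('a :: chilbert_space \<Rightarrow> 'b :: chilbert_space) \<Rightarrow> bool" where
  "unitary U \<longleftrightarrow> bounded_clinear U \<and> cadjoint U \<circ> U = id \<and> U \<circ> cadjoint U = id"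

definition spectrum :: "('a :: chilbert_space \<Rightarrow> 'a) \<Rightarrow> complex set" where
  "spectrum T = {c. \<not> (\<exists>S. bounded_clinear S \<and>
     (\<forall>x. S (T x - c *\<^sub>C x) = x) \<and> (\<forall>x. T (S x) - c *\<^sub>C S x = x))}"

text \<open>The case distinction is needed because \<open>dim\<close> is \<open>0\<close> on infinite-dimensional spaces.\<close>

definition op_rank :: "('a :: chilbert_space \<Rightarrow> 'b :: chilbert_space) \<Rightarrow> enat" where
  "op_rank T = (if \<exists>B. finite B \<and> range T \<subseteq> cvec.span B then enat (cvec.dim (range T)) else \<infinity>)"

definition orthonormal_basis :: "'a :: chilbert_space set \<Rightarrow> bool" where
  "orthonormal_basis E \<longleftrightarrow>
     (\<forall>e\<in>E. \<forall>f\<in>E. cinner e f = (if e = f then 1 else 0)) \<and> closure (cvec.span E) = UNIV"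

text \<open>
  The \<open>(f, e)\<close> entry of the matrix of \<open>T\<close> with respect to \<open>E\<close>, i.e. the
  \<open>f\<close>-coefficient of \<open>T e\<close>.
\<close>

definition mat_entry :: "('a :: chilbert_space \<Rightarrow> 'a) \<Rightarrow> 'a \<Rightarrow> 'a \<Rightarrow> complex" where
  "mat_entry T f e = cinner (T e) f"

definition op_transpose ::
    "'a :: chilbert_space set \<Rightarrow> ('a \<Rightarrow> 'a) \<Rightarrow> 'a \<Rightarrow> 'a" where
  "op_transpose E A =
     (THE T. bounded_clinear T \<and> (\<forall>e\<in>E. \<forall>f\<in>E. mat_entry T f e = mat_entry A e f))"

definition op_prod :: "('a \<Rightarrow> 'a) list \<Rightarrow> 'a \<Rightarrow> 'a" where
  "op_prod Ts = foldr (\<circ>) Ts id"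

definition gen_jordan_prod ::
    "nat list \<Rightarrow> (nat \<Rightarrow> 'a :: chilbert_space \<Rightarrow> 'a) \<Rightarrow> 'a \<Rightarrow> 'a" where
  "gen_jordan_prod is T = (\<lambda>x. op_prod (map T is) x + op_prod (map T (rev is)) x)"

end

theory Submission
  imports Defs
begin

text \<open>
  Put \<open>A\<close> at the position \<open>p\<close> that carries an unrepeated index and one operator \<open>B\<close> at all others. The
  generalized Jordan product becomes \<open>B\<^sup>r A B\<^sup>s + B\<^sup>s A B\<^sup>r\<close> with \<open>r + s = m - 1 \<ge> 1\<close>; the
  proof works with the spectra of these operators.

  If \<open>A\<close> or \<open>B\<close> is the projection onto a unit vector \<open>x\<close>, the product has the form
  \<open>u \<otimes> v + v \<otimes> u\<close> with \<open>\<langle>u, v\<rangle>\<close> real. Its non-zero spectral values are among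
  \<open>\<langle>u, v\<rangle> \<plusminus> \<parallel>u\<parallel> \<parallel>v\<parallel>\<close>. Two consequences carry the proof: there is at most one positive spectral
  value, and the spectrum determines \<open>\<langle>u, v\<rangle>\<close>, that is, half the trace. For \<open>B = x \<otimes> x\<close> this
  number is \<open>\<langle>A x, x\<rangle>\<close>.

  The first consequence shows that \<open>\<Phi>\<close> maps the projection \<open>x \<otimes> x\<close> to a multiple of a projection
  \<open>y \<otimes> y\<close>: an image \<open>C\<close> of higher rank would have an invertible compression to some plane, and a
  suitable \<open>B\<close> of rank two, close to rank one, would produce two different positive eigenvalues
  (\<open>image_rank_one_no_plane\<close>). The eigenvalues are found by maximizing the quadratic form, which works
  in any dimension because the operators involved are compact.

  The second consequence then gives \<open>\<langle>A x, x\<rangle> = \<xi> \<langle>\<Phi>(A) y, y\<rangle>\<close> for all \<open>A\<close>, with one sign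
  \<open>\<xi>\<close> for all \<open>x\<close> (\<open>form_preserving_map\<close>). For projections \<open>A\<close> this says that \<open>x \<mapsto> y\<close> preserves
  transition probabilities, so by Wigner's theorem \<open>y\<close> is, up to a phase, the image of \<open>x\<close> under a
  linear or conjugate-linear isometry \<open>W\<close>. In the second case \<open>W\<close> is composed with the conjugation
  \<open>J\<close> of the given basis, and \<open>J A J\<close> is the transpose of \<open>A\<close>. Surjectivity follows from the rank-one
  operators in the range of \<open>\<Phi>\<close> (\<open>unitary_if_form\<close>). Since quadratic forms determine self-adjoint
  operators, this is the assertion.
\<close>

section \<open>Complex inner products and self-adjoint operators\<close>

lemma cinner_add_right: "cinner x (y + z) = cinner x y + cinner x z"
  for x :: "'a :: chilbert_space"
  by (metis cinner_add_left cinner_commute complex_cnj_add)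

lemma cinner_scaleC_right: "cinner x (c *\<^sub>C y) = cnj c * cinner x y"
  for x :: "'a :: chilbert_space"
  by (metis cinner_commute cinner_scaleC_left complex_cnj_mult)

lemma cinner_zero_left [simp]: "cinner 0 x = 0" for x :: "'a :: chilbert_space"
  using cinner_scaleC_left[of 0 x x] by simp

lemma cinner_zero_right [simp]: "cinner x 0 = 0" for x :: "'a :: chilbert_space"
  using cinner_scaleC_right[of x 0 x] by simp

lemma cinner_minus_left: "cinner (- x) y = - cinner x y" for x :: "'a :: chilbert_space"
  using cinner_scaleC_left[of "-1" x y] by simp

lemma cinner_minus_right: "cinner y (- x) = - cinner y x" for x :: "'a :: chilbert_space"
  using cinner_scaleC_right[of y "-1" x] by simp

lemma cinner_diff_left: "cinner (x - y) z = cinner x z - cinner y z" for x :: "'a :: chilbert_space"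
  using cinner_add_left[of x "- y" z] by (simp add: cinner_minus_left)

lemma cinner_diff_right: "cinner z (x - y) = cinner z x - cinner z y" for x :: "'a :: chilbert_space"
  using cinner_add_right[of z x "- y"] by (simp add: cinner_minus_right)

lemma cinner_scaleR_left: "cinner (r *\<^sub>R x) y = of_real r * cinner x y"
  for x :: "'a :: chilbert_space"
  by (metis cinner_scaleC_left scaleC_of_real)

lemma cinner_scaleR_right: "cinner x (r *\<^sub>R y) = of_real r * cinner x y"
  for x :: "'a :: chilbert_space"
  by (metis cinner_scaleC_right complex_cnj_complex_of_real scaleC_of_real)

lemmas cinner_algebra = cinner_add_left cinner_add_right cinner_diff_left cinner_diff_right
  cinner_minus_left cinner_minus_right cinner_scaleC_left cinner_scaleC_right
  cinner_scaleR_left cinner_scaleR_right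

lemma scaleC_scaleR: "c *\<^sub>C r *\<^sub>R x = r *\<^sub>R c *\<^sub>C x" for x :: "'a :: chilbert_space"
  by (metis mult.commute scaleC_of_real scaleC_scaleC)

lemma inner_scaleC_i: "x \<bullet> (\<i> *\<^sub>C y) = Im (cinner x y)" for x :: "'a :: chilbert_space"
  by (simp add: Re_cinner[symmetric] cinner_scaleC_right)

lemma norm_scaleC: "norm (c *\<^sub>C x) = cmod c * norm x" for x :: "'a :: chilbert_space"
proof -
  have "of_real ((norm (c *\<^sub>C x))\<^sup>2) = (of_real ((cmod c * norm x)\<^sup>2) :: complex)"
    using complex_norm_square[of c] cinner_self[of x] cinner_self[of "c *\<^sub>C x"]
    by (simp add: cinner_scaleC_left cinner_scaleC_right power_mult_distrib mult_ac)
  then have "(norm (c *\<^sub>C x))\<^sup>2 = (cmod c * norm x)\<^sup>2"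
    using of_real_eq_iff by blast
  then show ?thesis by (simp add: power2_eq_iff_nonneg)
qed

lemma norm_cinner_le: "cmod (cinner x y) \<le> norm x * norm y" for x :: "'a :: chilbert_space"
proof (cases "cinner x y = 0")
  case False
  define c where "c = cnj (cinner x y) / cmod (cinner x y)"
  have c: "cmod c = 1" using False by (simp add: c_def norm_divide)
  have "cinner (c *\<^sub>C x) y = cmod (cinner x y)"
    using False complex_norm_square[of "cinner x y"]
    by (simp add: c_def cinner_scaleC_left field_simps power2_eq_square)
  then have "cmod (cinner x y) = (c *\<^sub>C x) \<bullet> y"
    by (metis Re_complex_of_real Re_cinner)
  also have "\<dots> \<le> norm (c *\<^sub>C x) * norm y" by (rule norm_cauchy_schwarz)
  finally show ?thesis using c by (simp add: norm_scaleC)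
qed simp

text \<open>The equality case of the Cauchy--Schwarz inequality: expand the square of the distance from
  \<^term>\<open>a\<close> to its projection onto the line of \<^term>\<open>b\<close>.\<close>

lemma parallel_if_norm_cinner_eq:
  fixes a b :: "'a :: chilbert_space"
  assumes "cmod (cinner a b) = norm a * norm b" and "norm a = norm b"
  obtains c where "cmod c = 1" "a = c *\<^sub>C b"
proof (cases "b = 0")
  case True
  then show ?thesis using assms that[of 1] by simp
next
  case False
  define c where "c = cinner a b / (norm b)\<^sup>2"
  have cc: "cinner a b = c * (norm b)\<^sup>2" using False by (simp add: c_def)
  have c1: "cmod c = 1" using assms False by (simp add: c_def norm_divide norm_power power2_eq_square norm_mult)
  have "cinner (a - c *\<^sub>C b) (a - c *\<^sub>C b)
      = (norm a)\<^sup>2 - c * cnj (cinner a b) - cnj c * cinner a b + c * cnj c * (norm b)\<^sup>2"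
    unfolding cinner_self[of a, symmetric] cinner_self[of b, symmetric] cinner_commute[of a b, symmetric]
    by (simp add: cinner_algebra algebra_simps cinner_commute[of b a])
  also have "\<dots> = 0"
    using assms c1 complex_norm_square[of c] by (simp add: cc algebra_simps)
  finally have "norm (a - c *\<^sub>C b) = 0" by (simp add: cinner_self)
  then show ?thesis using c1 that[of c] by simp
qed

lemma bounded_clinear_intro:
  fixes T :: "'a :: chilbert_space \<Rightarrow> 'b :: chilbert_space"
  assumes "\<And>x y. T (x + y) = T x + T y" and C: "\<And>c x. T (c *\<^sub>C x) = c *\<^sub>C T x"
    and "\<And>x. norm (T x) \<le> norm x * K"
  shows "bounded_clinear T"
  unfolding bounded_clinear_def
proof (intro conjI allI bounded_linear_intro[of T K])
  show "T (r *\<^sub>R x) = r *\<^sub>R T x" for r x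
    using C[of "of_real r" x] by (simp add: scaleC_of_real)
qed (use assms in auto)

lemma bounded_clinear_linear: "bounded_clinear T \<Longrightarrow> bounded_linear T"
  by (simp add: bounded_clinear_def)

lemma bounded_clinear_scaleC: "bounded_clinear T \<Longrightarrow> T (c *\<^sub>C x) = c *\<^sub>C T x"
  by (simp add: bounded_clinear_def)

lemma bounded_clinear_id: "bounded_clinear (\<lambda>x. x)"
  by (simp add: bounded_clinear_def bounded_linear_ident)

lemma bounded_clinear_compose:
  "bounded_clinear S \<Longrightarrow> bounded_clinear T \<Longrightarrow> bounded_clinear (\<lambda>x. S (T x))"
  by (simp add: bounded_clinear_def bounded_linear_compose)

lemma bounded_clinear_add:
  "bounded_clinear S \<Longrightarrow> bounded_clinear T \<Longrightarrow> bounded_clinear (\<lambda>x. S x + T x)"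
  by (simp add: bounded_clinear_def bounded_linear_add scaleC_add_right)

lemma bounded_clinear_const_scaleR:
  "bounded_clinear T \<Longrightarrow> bounded_clinear (\<lambda>x. r *\<^sub>R T x)"
  by (simp add: bounded_clinear_def bounded_linear_scaleR_right bounded_linear_const_scaleR scaleC_scaleR)

lemma bounded_clinear_funpow: "bounded_clinear T \<Longrightarrow> bounded_clinear (T ^^ j)"
  for T :: "'a :: chilbert_space \<Rightarrow> 'a"
proof (induction j)
  case (Suc j)
  then show ?case using bounded_clinear_compose[of T "T ^^ j"] by (simp add: o_def)
qed (simp add: bounded_clinear_id id_def)

lemma selfadjoint_ops_iff:
  "A \<in> selfadjoint_ops \<longleftrightarrow> bounded_clinear A \<and> (\<forall>x y. cinner (A x) y = cinner x (A y))"
  by (simp add: selfadjoint_ops_def is_cadjoint_def)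

lemma selfadjoint_clinear: "A \<in> selfadjoint_ops \<Longrightarrow> bounded_clinear A"
  by (simp add: selfadjoint_ops_iff)

lemma selfadjoint_linear: "A \<in> selfadjoint_ops \<Longrightarrow> bounded_linear A"
  by (simp add: selfadjoint_ops_iff bounded_clinear_def)

lemma selfadjoint_cinner: "A \<in> selfadjoint_ops \<Longrightarrow> cinner (A x) y = cinner x (A y)"
  by (simp add: selfadjoint_ops_iff)

lemma selfadjoint_inner: "A \<in> selfadjoint_ops \<Longrightarrow> A x \<bullet> y = x \<bullet> A y"
  by (metis selfadjoint_cinner Re_cinner)

lemma selfadjoint_form_real: "A \<in> selfadjoint_ops \<Longrightarrow> cinner (A x) x = of_real (A x \<bullet> x)"
  by (metis Re_cinner cinner_commute complex_eq_iff complex_of_real_def complex_cnj_cancel_iff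
      selfadjoint_cinner Im_complex_of_real Re_complex_of_real cnj.sel(2) neg_equal_zero)

lemma selfadjoint_zero: "(\<lambda>x. 0) \<in> selfadjoint_ops"
  by (simp add: selfadjoint_ops_iff bounded_clinear_def)

lemma selfadjoint_add:
  "A \<in> selfadjoint_ops \<Longrightarrow> B \<in> selfadjoint_ops \<Longrightarrow> (\<lambda>x. A x + B x) \<in> selfadjoint_ops"
  by (simp add: selfadjoint_ops_iff bounded_clinear_add cinner_algebra)

lemma selfadjoint_scaleR:
  "A \<in> selfadjoint_ops \<Longrightarrow> (\<lambda>x. r *\<^sub>R A x) \<in> selfadjoint_ops"
  by (simp add: selfadjoint_ops_iff bounded_clinear_const_scaleR cinner_algebra)

lemma selfadjoint_diff:
  "A \<in> selfadjoint_ops \<Longrightarrow> B \<in> selfadjoint_ops \<Longrightarrow> (\<lambda>x. A x - B x) \<in> selfadjoint_ops"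
  using selfadjoint_add[of A "\<lambda>x. (-1) *\<^sub>R B x"] selfadjoint_scaleR[of B "-1"] by simp

lemma selfadjoint_funpow_cinner:
  "A \<in> selfadjoint_ops \<Longrightarrow> cinner ((A ^^ j) x) y = cinner x ((A ^^ j) y)"
  by (induction j arbitrary: x y) (simp_all add: selfadjoint_cinner funpow_swap1)

lemma selfadjoint_funpow: "A \<in> selfadjoint_ops \<Longrightarrow> A ^^ j \<in> selfadjoint_ops"
  unfolding selfadjoint_ops_iff
  using bounded_clinear_funpow selfadjoint_funpow_cinner selfadjoint_ops_iff by blast

text \<open>By polarization, the quadratic form determines a self-adjoint operator.\<close>

lemma selfadjoint_eqI:
  assumes A: "A \<in> selfadjoint_ops" and B: "B \<in> selfadjoint_ops"
    and eq: "\<And>x. A x \<bullet> x = B x \<bullet> x"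
  shows "A = B"
proof
  fix x
  define D where "D = (\<lambda>x. A x - B x)"
  have D: "D \<in> selfadjoint_ops" unfolding D_def by (rule selfadjoint_diff[OF A B])
  have D0: "D y \<bullet> y = 0" for y by (simp add: D_def eq inner_diff_left)
  interpret D: bounded_linear D by (rule selfadjoint_linear[OF D])
  have "0 = D (x + D x) \<bullet> (x + D x)" using D0 by simp
  also have "\<dots> = D x \<bullet> x + D x \<bullet> D x + D (D x) \<bullet> x + D (D x) \<bullet> D x"
    by (simp add: D.add inner_add_left inner_add_right)
  also have "\<dots> = 2 * (D x \<bullet> D x)"
    using selfadjoint_inner[OF D, of "D x" x] D0[of x] D0[of "D x"] by simp
  finally show "A x = B x" by (simp add: D_def)
qed

section \<open>Operators of rank at most two\<close>

definition rank_one :: "'a :: chilbert_space \<Rightarrow> 'a \<Rightarrow> 'a" where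
  "rank_one x h = cinner h x *\<^sub>C x"

text \<open>This is \<open>u \<otimes> v + v \<otimes> u\<close>, where \<open>(u \<otimes> v) h = \<langle>h, v\<rangle> u\<close>.\<close>

definition sym_tensor :: "'a :: chilbert_space \<Rightarrow> 'a \<Rightarrow> 'a \<Rightarrow> 'a" where
  "sym_tensor u v h = cinner h v *\<^sub>C u + cinner h u *\<^sub>C v"

lemma bounded_clinear_tensor: "bounded_clinear (\<lambda>h. cinner h v *\<^sub>C u)"
  for u v :: "'a :: chilbert_space"
proof (rule bounded_clinear_intro[where K = "norm v * norm u"])
  show "norm (cinner h v *\<^sub>C u) \<le> norm h * (norm v * norm u)" for h
    using mult_right_mono[OF norm_cinner_le[of h v], of "norm u"] by (simp add: norm_scaleC mult.assoc)
qed (simp_all add: cinner_algebra scaleC_add_left scaleC_scaleC)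

lemma selfadjoint_rank_one: "rank_one x \<in> selfadjoint_ops"
  unfolding selfadjoint_ops_iff rank_one_def[abs_def]
  by (auto simp: bounded_clinear_tensor cinner_algebra) (metis cinner_commute mult.commute)

lemma rank_one_form: "rank_one x h \<bullet> h = (cmod (cinner h x))\<^sup>2"
proof -
  have "cinner (rank_one x h) h = of_real ((cmod (cinner h x))\<^sup>2)"
    by (simp add: rank_one_def cinner_algebra) (metis cinner_commute complex_norm_square of_real_power)
  then show ?thesis by (metis Re_complex_of_real Re_cinner)
qed

lemma op_rank_le:
  fixes T :: "'a :: chilbert_space \<Rightarrow> 'b :: chilbert_space"
  assumes "finite B" "card B \<le> j" and "range T \<subseteq> cvec.span B"
  shows "op_rank T \<le> enat j"
proof -
  have "cvec.dim (range T) \<le> card B" by (rule cvec.dim_le_card) (use assms in auto)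
  with assms show ?thesis unfolding op_rank_def by auto
qed

lemma op_rank_zero: "op_rank (\<lambda>x. 0) \<le> 1"
  using op_rank_le[of "{}" 1 "\<lambda>x. 0"] by (simp add: image_subset_iff one_enat_def)

lemma op_rank_scale_rank_one: "op_rank (\<lambda>h. r *\<^sub>R rank_one x h) \<le> 1"
proof -
  have "range (\<lambda>h. r *\<^sub>R rank_one x h) \<subseteq> cvec.span {x}"
    by (auto simp: rank_one_def scaleC_of_real[symmetric] simp del: cvec.scale_scale
        intro!: cvec.span_scale intro: cvec.span_base)
  from op_rank_le[OF _ _ this, of 1] show ?thesis by (simp add: one_enat_def)
qed

lemma op_rank_rank_one: "op_rank (rank_one x) \<le> 1"
  using op_rank_scale_rank_one[of 1 x] by simp

lemma op_rank_two:
  "op_rank (\<lambda>h. a *\<^sub>R rank_one x h + b *\<^sub>R rank_one y h) \<le> 3"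
proof -
  have "range (\<lambda>h. a *\<^sub>R rank_one x h + b *\<^sub>R rank_one y h) \<subseteq> cvec.span {x, y}"
    by (auto simp: rank_one_def scaleC_of_real[symmetric]
        intro!: cvec.span_scale cvec.span_add intro: cvec.span_base)
  from op_rank_le[OF _ _ this, of 3] show ?thesis
    by (simp add: numeral_eq_enat card_insert_if)
qed

lemma eigenvalue_in_spectrum:
  assumes "T h = c *\<^sub>C h" and "h \<noteq> 0"
  shows "c \<in> spectrum T"
proof -
  have False if S: "bounded_clinear S" and inv: "\<And>x. S (T x - c *\<^sub>C x) = x" for S
  proof -
    have "h = S 0" using inv[of h] assms by simp
    also have "S 0 = 0" using S by (simp add: bounded_clinear_def linear_0 bounded_linear.linear)
    finally show False using assms by simp
  qed
  then show ?thesis unfolding spectrum_def by auto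
qed

text \<open>If \<open>p\<close> is a polynomial with \<open>p(T) = 0\<close> and \<open>p(\<mu>) \<noteq> 0\<close>, then dividing \<open>p(t) - p(\<mu>)\<close> by
  \<open>t - \<mu>\<close> yields an inverse of \<open>T - \<mu>\<close> that is a polynomial in \<open>T\<close>. Here \<open>p\<close> is a monic cubic
  polynomial without constant term.\<close>

lemma spectrum_root_of_annihilator:
  assumes T: "bounded_clinear T"
    and ann: "\<And>h. T (T (T h)) = a *\<^sub>C T (T h) - b *\<^sub>C T h"
    and \<mu>: "\<mu> \<in> spectrum T"
  shows "\<mu> ^ 3 - a * \<mu>\<^sup>2 + b * \<mu> = 0"
proof (rule ccontr)
  define p where "p = \<mu> ^ 3 - a * \<mu>\<^sup>2 + b * \<mu>"
  define S where "S = (\<lambda>h. (- 1 / p) *\<^sub>C (T (T h) + (\<mu> - a) *\<^sub>C T h + (\<mu>\<^sup>2 - a * \<mu> + b) *\<^sub>C h))"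
  assume "\<mu> ^ 3 - a * \<mu>\<^sup>2 + b * \<mu> \<noteq> 0"
  then have p0: "p \<noteq> 0" by (simp add: p_def)
  interpret T: bounded_linear T by (rule bounded_clinear_linear[OF T])
  note TC = bounded_clinear_scaleC[OF T]
  have scale: "bounded_clinear (\<lambda>h::'a. c *\<^sub>C h)" for c
    by (rule bounded_clinear_intro[where K = "cmod c"])
      (simp_all add: scaleC_add_right scaleC_scaleC norm_scaleC mult.commute)
  have "bounded_clinear S"
    unfolding S_def
    by (intro bounded_clinear_compose[OF scale] bounded_clinear_add bounded_clinear_compose[OF T] T scale)
  moreover have "S (T h - \<mu> *\<^sub>C h) = h" "T (S h) - \<mu> *\<^sub>C S h = h" for h
  proof -
    have "T (T (T h)) + (\<mu> - a) *\<^sub>C T (T h) + (\<mu>\<^sup>2 - a * \<mu> + b) *\<^sub>C T h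
        - \<mu> *\<^sub>C (T (T h) + (\<mu> - a) *\<^sub>C T h + (\<mu>\<^sup>2 - a * \<mu> + b) *\<^sub>C h) = (- p) *\<^sub>C h"
      unfolding ann
      by (simp add: p_def cvec.scale_right_distrib cvec.scale_left_distrib cvec.scale_left_diff_distrib
          cvec.scale_right_diff_distrib scaleC_scaleC algebra_simps power2_eq_square power3_eq_cube)
    then have *: "(- 1 / p) *\<^sub>C (T (T (T h)) + (\<mu> - a) *\<^sub>C T (T h) + (\<mu>\<^sup>2 - a * \<mu> + b) *\<^sub>C T h
        - \<mu> *\<^sub>C (T (T h) + (\<mu> - a) *\<^sub>C T h + (\<mu>\<^sup>2 - a * \<mu> + b) *\<^sub>C h)) = h"
      using p0 by (simp add: scaleC_scaleC scaleC_one)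
    show "T (S h) - \<mu> *\<^sub>C S h = h"
      by (subst (3) *[symmetric])
        (simp add: S_def TC T.add T.neg cvec.scale_right_diff_distrib cvec.scale_left_commute)
    show "S (T h - \<mu> *\<^sub>C h) = h"
      by (subst (3) *[symmetric])
        (simp add: S_def TC T.diff cvec.scale_right_diff_distrib cvec.scale_right_distrib
          cvec.scale_left_commute algebra_simps)
  qed
  ultimately have "\<mu> \<notin> spectrum T" unfolding spectrum_def by blast
  with \<mu> show False by simp
qed

lemma bounded_clinear_sym_tensor: "bounded_clinear (sym_tensor u v)"
  unfolding sym_tensor_def[abs_def]
  by (intro bounded_clinear_add bounded_clinear_tensor)

lemma spectrum_sym_tensor:
  fixes u v :: "'a :: chilbert_space"
  assumes "Im (cinner u v) = 0"
  shows "spectrum (sym_tensor u v) - {0}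
    = {of_real (u \<bullet> v + norm u * norm v), of_real (u \<bullet> v - norm u * norm v)} - {0}"
proof -
  define p where "p = u \<bullet> v"
  define q where "q = norm u * norm v"
  have uv: "cinner u v = of_real p"
    using assms by (simp add: p_def complex_eq_iff Re_cinner)
  have vu: "cinner v u = of_real p"
    using uv cinner_commute[of v u] by simp
  have uu: "cinner u u = of_real ((norm u)\<^sup>2)" and vv: "cinner v v = of_real ((norm v)\<^sup>2)"
    by (rule cinner_self)+
  have T: "sym_tensor u v (a *\<^sub>C u + b *\<^sub>C v)
      = (a * p + b * (norm v)\<^sup>2) *\<^sub>C u + (a * (norm u)\<^sup>2 + b * p) *\<^sub>C v" for a b
    by (simp add: sym_tensor_def cinner_algebra uv vu uu vv)
  \<comment> \<open>By Cayley--Hamilton on the span of \<open>u\<close> and \<open>v\<close>, which contains the range.\<close>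
  have ann: "sym_tensor u v (sym_tensor u v (sym_tensor u v h))
      = of_real (2 * p) *\<^sub>C sym_tensor u v (sym_tensor u v h)
        - of_real (p\<^sup>2 - q\<^sup>2) *\<^sub>C sym_tensor u v h" for h
  proof -
    define a b where "a = cinner h v" and "b = cinner h u"
    have h: "sym_tensor u v h = a *\<^sub>C u + b *\<^sub>C v" by (simp add: a_def b_def sym_tensor_def)
    have lin: "k *\<^sub>C (x *\<^sub>C u + y *\<^sub>C v) - l *\<^sub>C (x' *\<^sub>C u + y' *\<^sub>C v)
        = (k * x - l * x') *\<^sub>C u + (k * y - l * y') *\<^sub>C v" for k l x y x' y'
      by (simp add: scaleC_add_right cvec.scale_left_diff_distrib)
    show ?thesis unfolding h T lin
      by (rule arg_cong2[where f = "(+)"]; rule arg_cong2[where f = scaleC])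
        (simp_all add: q_def power2_eq_square algebra_simps)
  qed
  have sub: "\<mu> = of_real (p + q) \<or> \<mu> = of_real (p - q)"
    if "\<mu> \<in> spectrum (sym_tensor u v)" "\<mu> \<noteq> 0" for \<mu>
  proof -
    have "\<mu> * ((\<mu> - of_real (p + q)) * (\<mu> - of_real (p - q))) = 0"
      using spectrum_root_of_annihilator[OF bounded_clinear_sym_tensor ann that(1)]
      by (simp add: algebra_simps power2_eq_square power3_eq_cube)
    then show ?thesis using that by auto
  qed
  have sup: "of_real (p + s * q) \<in> spectrum (sym_tensor u v)" if s: "s \<in> {1, -1}" and "p + s * q \<noteq> 0" for s
  proof (rule eigenvalue_in_spectrum)
    define w where "w = of_real (norm v) *\<^sub>C u + of_real (s * norm u) *\<^sub>C v"
    show "sym_tensor u v (of_real (norm v) *\<^sub>C u + of_real (s * norm u) *\<^sub>C v)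
      = of_real (p + s * q) *\<^sub>C (of_real (norm v) *\<^sub>C u + of_real (s * norm u) *\<^sub>C v)"
      unfolding T using s
      by (auto simp: q_def scaleC_add_right scaleC_scaleC algebra_simps power2_eq_square)
    have "complex_of_real (2 * s * q * (p + s * q)) = cinner w w"
      using s by (auto simp: w_def cinner_algebra uv vu uu vv q_def algebra_simps power2_eq_square)
    moreover have "q \<noteq> 0"
      using that Cauchy_Schwarz_ineq2[of u v] by (auto simp: p_def q_def)
    moreover have "s \<noteq> 0" using s by auto
    ultimately have "w \<noteq> 0" using that by (auto simp del: of_real_mult of_real_add)
    then show "of_real (norm v) *\<^sub>C u + of_real (s * norm u) *\<^sub>C v \<noteq> 0" by (simp add: w_def)
  qed
  show ?thesis unfolding p_def[symmetric] q_def[symmetric]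
    using sub sup[of 1] sup[of "-1"]
    by (auto simp del: of_real_add of_real_diff of_real_mult)
qed

text \<open>Of the two candidates \<open>u \<bullet> v \<plusminus> \<parallel>u\<parallel> \<parallel>v\<parallel>\<close> for a non-zero spectral value, one is \<open>\<ge> 0\<close> and the
  other is \<open>\<le> 0\<close> by the Cauchy--Schwarz inequality. So they can be told apart, and the
  spectrum as a mere set determines their sum, the trace.\<close>

lemma inner_determined_by_spectrum:
  fixes u v :: "'a :: chilbert_space" and u' v' :: "'b :: chilbert_space"
  assumes "Im (cinner u v) = 0" "Im (cinner u' v') = 0"
    and "spectrum (sym_tensor u v) = spectrum (sym_tensor u' v')"
  shows "u \<bullet> v = u' \<bullet> v'"
proof -
  define a b where "a = u \<bullet> v + norm u * norm v" and "b = u \<bullet> v - norm u * norm v"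
  define a' b' where "a' = u' \<bullet> v' + norm u' * norm v'" and "b' = u' \<bullet> v' - norm u' * norm v'"
  have "{complex_of_real a, of_real b} - {0} = {of_real a', of_real b'} - {0}"
    using spectrum_sym_tensor[OF assms(1)] spectrum_sym_tensor[OF assms(2)] assms(3)
    by (simp add: a_def b_def a'_def b'_def)
  then have "complex_of_real ` ({a, b} - {0}) = complex_of_real ` ({a', b'} - {0})"
    by (simp add: image_set_diff inj_of_real)
  then have *: "{a, b} - {0} = {a', b'} - {0}"
    by (simp add: inj_image_eq_iff inj_of_real)
  have "a \<ge> 0" "a' \<ge> 0" "b \<le> 0" "b' \<le> 0"
    unfolding a_def b_def a'_def b'_def
    using Cauchy_Schwarz_ineq2[of u v] Cauchy_Schwarz_ineq2[of u' v'] by (auto simp: abs_le_iff)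
  have "x = x'" if "x \<ge> 0" "x' \<ge> 0" "y \<le> 0" "y' \<le> 0" and eq: "{x, y} - {0} = {x', y'} - {0}"
    for x y x' y' :: real
  proof -
    have "x \<noteq> 0 \<Longrightarrow> x \<in> {x', y'}" "x' \<noteq> 0 \<Longrightarrow> x' \<in> {x, y}" using eq by blast+
    then show ?thesis using that(1-4) by force
  qed
  note max_eq = this
  have "uminus ` ({b, a} - {0}) = uminus ` ({b', a'} - {0})" using * by (simp add: insert_commute)
  then have "{- b, - a} - {0} = {- b', - a'} - {0}"
    by (simp add: image_set_diff inj_uminus)
  with * \<open>a \<ge> 0\<close> \<open>a' \<ge> 0\<close> \<open>b \<le> 0\<close> \<open>b' \<le> 0\<close> have "a = a'" "b = b'"
    using max_eq[of a a' b b'] max_eq[of "- b" "- b'" "- a" "- a'"] by auto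
  then show ?thesis unfolding a_def b_def a'_def b'_def by simp
qed

lemma positive_spectral_value_unique:
  fixes u v :: "'a :: chilbert_space"
  assumes "Im (cinner u v) = 0"
    and "of_real \<mu> \<in> spectrum (sym_tensor u v)" "of_real \<nu> \<in> spectrum (sym_tensor u v)"
    and "\<mu> > 0" "\<nu> > 0"
  shows "\<mu> = \<nu>"
proof -
  have "x = u \<bullet> v + norm u * norm v"
    if "of_real x \<in> spectrum (sym_tensor u v)" "x > 0" for x
  proof -
    have "complex_of_real x \<in> spectrum (sym_tensor u v) - {0}" using that by simp
    then have "complex_of_real x = of_real (u \<bullet> v + norm u * norm v)
        \<or> complex_of_real x = of_real (u \<bullet> v - norm u * norm v)"
      unfolding spectrum_sym_tensor[OF assms(1)] by blast
    then have "x = u \<bullet> v + norm u * norm v \<or> x = u \<bullet> v - norm u * norm v"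
      unfolding of_real_eq_iff .
    moreover have "u \<bullet> v - norm u * norm v \<le> 0" using norm_cauchy_schwarz[of u v] by simp
    ultimately show ?thesis using that(2) by linarith
  qed
  from this[OF assms(2,4)] this[OF assms(3,5)] show ?thesis by simp
qed

section \<open>Positive eigenvalues of compact self-adjoint operators\<close>

definition compact_op :: "('a :: chilbert_space \<Rightarrow> 'a) \<Rightarrow> bool" where
  "compact_op T \<longleftrightarrow>
    (\<forall>x. bounded (range x) \<longrightarrow> (\<exists>r. strict_mono (r :: nat \<Rightarrow> nat) \<and> convergent (\<lambda>j. T (x (r j)))))"

lemma compact_op_tensor: "compact_op (\<lambda>h. cinner h v *\<^sub>C u)"
  unfolding compact_op_def
proof (intro allI impI)
  fix x :: "nat \<Rightarrow> 'a" assume "bounded (range x)"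
  then obtain K where K: "\<And>j. norm (x j) \<le> K" by (auto simp: bounded_iff)
  have "cmod (cinner (x j) v) \<le> K * norm v" for j
    using norm_cinner_le[of "x j" v] mult_right_mono[OF K, of "norm v" j] by simp
  then have "bounded (range (\<lambda>j. cinner (x j) v))" by (auto simp: bounded_iff)
  from bounded_imp_convergent_subsequence[OF this]
  obtain l r where r: "strict_mono r" and l: "((\<lambda>j. cinner (x j) v) \<circ> r) \<longlonglongrightarrow> l" by blast
  have "bounded_linear (\<lambda>c. c *\<^sub>C u)"
  proof (rule bounded_linear_intro[where K = "norm u"])
    show "(r *\<^sub>R c) *\<^sub>C u = r *\<^sub>R (c *\<^sub>C u)" for r c
      by (metis scaleR_conv_of_real scaleC_scaleC scaleC_of_real)
  qed (simp_all add: scaleC_add_left norm_scaleC)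
  from bounded_linear.tendsto[OF this l]
  have "(\<lambda>j. cinner (x (r j)) v *\<^sub>C u) \<longlonglongrightarrow> l *\<^sub>C u" by simp
  with r show "\<exists>r. strict_mono r \<and> convergent (\<lambda>j. cinner (x (r j)) v *\<^sub>C u)"
    by (auto simp: convergent_def)
qed

lemma compact_op_rank_one: "compact_op (rank_one x)"
  using compact_op_tensor[of x x] by (simp add: rank_one_def[abs_def])

lemma compact_op_scaleR:
  assumes "compact_op S"
  shows "compact_op (\<lambda>h. a *\<^sub>R S h)"
  unfolding compact_op_def
proof (intro allI impI)
  fix x :: "nat \<Rightarrow> 'a" assume "bounded (range x)"
  then obtain r l where r: "strict_mono r" and l: "(\<lambda>j. S (x (r j))) \<longlonglongrightarrow> l"
    using assms unfolding compact_op_def convergent_def by metis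
  from r convergentI[OF tendsto_scaleR[OF tendsto_const l]]
  show "\<exists>r. strict_mono (r :: nat \<Rightarrow> nat) \<and> convergent (\<lambda>j. a *\<^sub>R S (x (r j)))" by metis
qed

lemma compact_op_add:
  assumes S: "compact_op S" and T: "compact_op T"
  shows "compact_op (\<lambda>h. S h + T h)"
  unfolding compact_op_def
proof (intro allI impI)
  fix x :: "nat \<Rightarrow> 'a" assume x: "bounded (range x)"
  then obtain r where r: "strict_mono r" "convergent (\<lambda>j. S (x (r j)))"
    using S unfolding compact_op_def by blast
  have "bounded (range (\<lambda>j. x (r j)))" by (rule bounded_subset[OF x]) auto
  then obtain r' where r': "strict_mono r'" "convergent (\<lambda>j. T (x (r (r' j))))"
    using T unfolding compact_op_def by blast
  have "convergent (\<lambda>j. S (x (r (r' j))))"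
    using convergent_subseq_convergent[OF r(2) r'(1)] by (simp add: o_def)
  then have "convergent (\<lambda>j. S (x ((r \<circ> r') j)) + T (x ((r \<circ> r') j)))"
    using convergent_add[OF _ r'(2)] by (simp add: o_def)
  then show "\<exists>r. strict_mono (r :: nat \<Rightarrow> nat) \<and> convergent (\<lambda>j. S (x (r j)) + T (x (r j)))"
    using strict_mono_o[OF r(1) r'(1)] by blast
qed

lemma compact_op_compose_left:
  assumes S: "bounded_linear S" and T: "compact_op T"
  shows "compact_op (\<lambda>h. S (T h))"
  unfolding compact_op_def
proof (intro allI impI)
  fix x :: "nat \<Rightarrow> 'a" assume "bounded (range x)"
  then obtain r l where r: "strict_mono r" and l: "(\<lambda>j. T (x (r j))) \<longlonglongrightarrow> l"
    using T unfolding compact_op_def convergent_def by metis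
  from r convergentI[OF bounded_linear.tendsto[OF S l]]
  show "\<exists>r. strict_mono (r :: nat \<Rightarrow> nat) \<and> convergent (\<lambda>j. S (T (x (r j))))" by metis
qed

lemma compact_op_compose_right:
  assumes S: "bounded_linear S" and T: "compact_op T"
  shows "compact_op (\<lambda>h. T (S h))"
  unfolding compact_op_def
proof (intro allI impI)
  fix x :: "nat \<Rightarrow> 'a" assume "bounded (range x)"
  then have "bounded (range (\<lambda>j. S (x j)))"
    using bounded_linear_image[OF _ S, of "range x"] by (simp add: image_image)
  then show "\<exists>r. strict_mono (r :: nat \<Rightarrow> nat) \<and> convergent (\<lambda>j. T (S (x (r j))))"
    using T unfolding compact_op_def by blast
qed

text \<open>Approximate maximizers of the quadratic form on the unit sphere are approximate eigenvectors,
  since \<open>\<mu> - T\<close> is a positive operator, where \<open>\<mu>\<close> is the supremum. Compactness turns them into an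
  eigenvector.\<close>

lemma top_eigenvalue:
  fixes T :: "'a :: chilbert_space \<Rightarrow> 'a"
  assumes T: "T \<in> selfadjoint_ops" and cpt: "compact_op T" and z: "T z \<bullet> z > 0"
  obtains \<mu> h where "\<mu> > 0" "norm h = 1" "T h = \<mu> *\<^sub>R h" "\<And>v. T v \<bullet> v \<le> \<mu> * (norm v)\<^sup>2"
proof -
  interpret T: bounded_linear T by (rule selfadjoint_linear[OF T])
  obtain K where K: "\<And>x. norm (T x) \<le> norm x * K" and K0: "K \<ge> 0" using T.nonneg_bounded by blast
  define W where "W = (\<lambda>v. T v \<bullet> v) ` {v. norm v = 1}"
  define \<mu> where "\<mu> = Sup W"
  have bdd: "bdd_above W"
  proof (rule bdd_aboveI)
    fix y assume "y \<in> W"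
    then obtain v where v: "norm v = 1" "y = T v \<bullet> v" by (auto simp: W_def)
    show "y \<le> K" using norm_cauchy_schwarz[of "T v" v] K[of v] v by simp
  qed
  have le: "T v \<bullet> v \<le> \<mu> * (norm v)\<^sup>2" for v
  proof (cases "v = 0")
    case False
    have "T (v /\<^sub>R norm v) \<bullet> (v /\<^sub>R norm v) \<in> W"
      unfolding W_def using False by (intro imageI) simp
    then have "T (v /\<^sub>R norm v) \<bullet> (v /\<^sub>R norm v) \<le> \<mu>" unfolding \<mu>_def by (rule cSup_upper[OF _ bdd])
    then show ?thesis using False by (simp add: T.scaleR field_simps power2_eq_square)
  qed (simp add: T.zero)
  have "0 < \<mu> * (norm z)\<^sup>2" using z le[of z] by simp
  then have \<mu>0: "\<mu> > 0" by (simp add: zero_less_mult_iff)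
  have "z \<noteq> 0" using z by auto
  then have "norm (z /\<^sub>R norm z) = 1" by simp
  then have "W \<noteq> {}" unfolding W_def by blast
  have "\<exists>v. norm v = 1 \<and> T v \<bullet> v > \<mu> - inverse (Suc j)" for j
    using less_cSupE[of "\<mu> - inverse (Suc j)" W] \<open>W \<noteq> {}\<close> unfolding \<mu>_def W_def
    by (auto simp: image_iff)
  then obtain v where v1: "\<And>j. norm (v j) = 1" and v: "\<And>j. T (v j) \<bullet> v j > \<mu> - inverse (Suc j)"
    by metis
  define R where "R = (\<lambda>x. \<mu> *\<^sub>R x - T x)"
  define L where "L = \<mu> + K"
  have L0: "L > 0" using \<mu>0 K0 by (simp add: L_def)
  \<comment> \<open>Positivity of the form of \<open>\<mu> - T\<close> at \<open>x - R x / L\<close>, where \<open>L\<close> bounds its norm.\<close>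
  have R: "(norm (R x))\<^sup>2 \<le> L * (\<mu> * (norm x)\<^sup>2 - T x \<bullet> x)" for x
  proof -
    define t where "t = 1 / L"
    define q where "q = \<mu> * (norm x)\<^sup>2 - T x \<bullet> x"
    have sa: "T (R x) \<bullet> x = R x \<bullet> T x" by (rule selfadjoint_inner[OF T])
    have "norm (T (R x)) * norm (R x) \<le> K * (norm (R x))\<^sup>2"
      using mult_right_mono[OF K[of "R x"], of "norm (R x)"] by (simp add: power2_eq_square mult_ac)
    then have "- (T (R x) \<bullet> R x) \<le> K * (norm (R x))\<^sup>2"
      using norm_cauchy_schwarz[of "- T (R x)" "R x"] by simp
    then have b: "\<mu> * (norm (R x))\<^sup>2 - T (R x) \<bullet> R x \<le> L * (norm (R x))\<^sup>2"
      by (simp add: L_def algebra_simps)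
    have "0 \<le> \<mu> * (norm (x - t *\<^sub>R R x))\<^sup>2 - T (x - t *\<^sub>R R x) \<bullet> (x - t *\<^sub>R R x)"
      using le[of "x - t *\<^sub>R R x"] by simp
    also have "\<dots> = q - 2 * t * (R x \<bullet> (\<mu> *\<^sub>R x - T x))
        + t\<^sup>2 * (\<mu> * (norm (R x))\<^sup>2 - T (R x) \<bullet> R x)"
      unfolding power2_norm_eq_inner q_def
      using sa by (simp add: T.diff T.scaleR inner_diff_left inner_diff_right algebra_simps
          power2_eq_square inner_commute)
    also have "R x \<bullet> (\<mu> *\<^sub>R x - T x) = (norm (R x))\<^sup>2"
      unfolding R_def power2_norm_eq_inner ..
    also have "q - 2 * t * (norm (R x))\<^sup>2 + t\<^sup>2 * (\<mu> * (norm (R x))\<^sup>2 - T (R x) \<bullet> R x)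
        \<le> q - 2 * t * (norm (R x))\<^sup>2 + t\<^sup>2 * (L * (norm (R x))\<^sup>2)"
      using b by (simp add: mult_left_mono)
    also have "\<dots> = q - (norm (R x))\<^sup>2 / L"
      using L0 by (simp add: t_def power2_eq_square field_simps)
    finally show ?thesis using L0 by (simp add: q_def field_simps)
  qed
  have "(\<lambda>j. R (v j)) \<longlonglongrightarrow> 0"
  proof (rule tendsto_norm_zero_cancel)
    have "(\<lambda>j. (norm (R (v j)))\<^sup>2) \<longlonglongrightarrow> 0"
    proof (rule tendsto_sandwich[of "\<lambda>_. 0" _ _ "\<lambda>j. L * inverse (Suc j)"])
      show "\<forall>\<^sub>F j in sequentially. (norm (R (v j)))\<^sup>2 \<le> L * inverse (Suc j)"
      proof (intro always_eventually allI)
        fix j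
        have "L * (\<mu> * (norm (v j))\<^sup>2 - T (v j) \<bullet> v j) \<le> L * inverse (Suc j)"
          using v[of j] v1[of j] L0 by (intro mult_left_mono) auto
        then show "(norm (R (v j)))\<^sup>2 \<le> L * inverse (Suc j)" using R[of "v j"] by linarith
      qed
      show "(\<lambda>j. L * inverse (Suc j)) \<longlonglongrightarrow> 0"
        using tendsto_mult_right_zero[OF LIMSEQ_inverse_real_of_nat, of L] by simp
    qed auto
    from tendsto_real_sqrt[OF this] show "(\<lambda>j. norm (R (v j))) \<longlonglongrightarrow> 0" by simp
  qed
  moreover have "bounded (range v)" using v1 by (auto simp: bounded_iff intro!: exI[of _ 1])
  then obtain r where r: "strict_mono r" "convergent (\<lambda>j. T (v (r j)))"
    using cpt unfolding compact_op_def by blast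
  then obtain l where l: "(\<lambda>j. T (v (r j))) \<longlonglongrightarrow> l" by (auto simp: convergent_def)
  ultimately have "(\<lambda>j. R (v (r j))) \<longlonglongrightarrow> 0"
    using LIMSEQ_subseq_LIMSEQ[of "\<lambda>j. R (v j)" 0 r] r by (simp add: o_def)
  from tendsto_add[OF this l] have "(\<lambda>j. \<mu> *\<^sub>R v (r j)) \<longlonglongrightarrow> l" by (simp add: R_def)
  from tendsto_scaleR[OF tendsto_const this, of "inverse \<mu>"]
  have lim: "(\<lambda>j. v (r j)) \<longlonglongrightarrow> l /\<^sub>R \<mu>" using \<mu>0 by simp
  from tendsto_norm[OF this] have "norm (l /\<^sub>R \<mu>) = 1"
    using v1 by (simp add: LIMSEQ_const_iff)
  moreover have "T (l /\<^sub>R \<mu>) = l" using LIMSEQ_unique[OF T.tendsto[OF lim] l] .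
  ultimately show thesis using that[of \<mu> "l /\<^sub>R \<mu>"] \<mu>0 le by auto
qed

text \<open>The form is positive on a plane, so it stays positive somewhere after one eigenvector is split off.
  This yields a second eigenvector, orthogonal to the first one and, by uniqueness, with the same
  eigenvalue. Thus the eigenspace has dimension at least two and meets every hyperplane.\<close>

lemma eigenvector_in_hyperplane:
  fixes T :: "'a :: chilbert_space \<Rightarrow> 'a"
  assumes T: "T \<in> selfadjoint_ops" and cpt: "compact_op T"
    and pos: "\<And>a b. a *\<^sub>C e1 + b *\<^sub>C e2 \<noteq> 0 \<Longrightarrow> T (a *\<^sub>C e1 + b *\<^sub>C e2) \<bullet> (a *\<^sub>C e1 + b *\<^sub>C e2) > 0"
    and e: "norm e1 = 1" "norm e2 = 1" "cinner e1 e2 = 0"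
    and unique: "\<And>\<mu> \<nu>. of_real \<mu> \<in> spectrum T \<Longrightarrow> of_real \<nu> \<in> spectrum T \<Longrightarrow> \<mu> > 0 \<Longrightarrow> \<nu> > 0 \<Longrightarrow> \<mu> = \<nu>"
  obtains \<mu> h where "T h = \<mu> *\<^sub>R h" "norm h = 1" "cinner h e1 = 0" "T e1 \<bullet> e1 \<le> \<mu>"
proof -
  have e21: "cinner e2 e1 = 0" using e(3) cinner_commute[of e2 e1] by simp
  have e11: "cinner e1 e1 = 1" "cinner e2 e2 = 1" using e by (simp_all add: cinner_self)
  have "e1 \<noteq> 0" using e(1) by auto
  then have "T e1 \<bullet> e1 > 0" using pos[of 1 0] by simp
  from top_eigenvalue[OF T cpt this] obtain \<mu> h where \<mu>: "\<mu> > 0" and h: "norm h = 1"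
    and Th: "T h = \<mu> *\<^sub>R h" and le: "\<And>v. T v \<bullet> v \<le> \<mu> * (norm v)\<^sup>2" by blast
  interpret T: bounded_linear T by (rule selfadjoint_linear[OF T])
  define T' where "T' = (\<lambda>x. T x + (- \<mu>) *\<^sub>R rank_one h x)"
  have T': "T' \<in> selfadjoint_ops"
    unfolding T'_def by (intro selfadjoint_add T selfadjoint_scaleR selfadjoint_rank_one)
  have cpt': "compact_op T'"
    unfolding T'_def by (intro compact_op_add cpt compact_op_scaleR compact_op_rank_one)
  obtain a b where nz: "a *\<^sub>C e1 + b *\<^sub>C e2 \<noteq> 0" and perp: "cinner (a *\<^sub>C e1 + b *\<^sub>C e2) h = 0"
  proof (cases "cinner e1 h = 0")
    case True
    then show ?thesis using \<open>e1 \<noteq> 0\<close> that[of 1 0] by simp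
  next
    case False
    have "cinner (cinner e2 h *\<^sub>C e1 + (- cinner e1 h) *\<^sub>C e2) e2 \<noteq> 0"
      using False e11 e by (simp add: cinner_algebra)
    then have "cinner e2 h *\<^sub>C e1 + (- cinner e1 h) *\<^sub>C e2 \<noteq> 0" by (metis cinner_zero_left)
    then show ?thesis using that[of "cinner e2 h" "- cinner e1 h"] by (simp add: cinner_algebra)
  qed
  have "T' (a *\<^sub>C e1 + b *\<^sub>C e2) \<bullet> (a *\<^sub>C e1 + b *\<^sub>C e2) > 0"
    using pos[OF nz] perp by (simp add: T'_def rank_one_def)
  from top_eigenvalue[OF T' cpt' this] obtain \<nu> g where \<nu>: "\<nu> > 0" and g: "norm g = 1"
    and T'g: "T' g = \<nu> *\<^sub>R g" by blast
  have hh: "cinner h h = 1" using h by (simp add: cinner_self)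
  have "T' h = 0" by (simp add: T'_def Th rank_one_def hh scaleC_one)
  then have "cinner (T' g) h = 0" by (simp add: selfadjoint_cinner[OF T'])
  then have gh: "cinner g h = 0" using \<nu> by (simp add: T'g cinner_scaleR_left)
  then have Tg: "T g = \<nu> *\<^sub>R g" using T'g by (simp add: T'_def rank_one_def)
  have "h \<noteq> 0" "g \<noteq> 0" using h g by auto
  then have "of_real \<mu> \<in> spectrum T" "of_real \<nu> \<in> spectrum T"
    using eigenvalue_in_spectrum[of T h "of_real \<mu>"] eigenvalue_in_spectrum[of T g "of_real \<nu>"]
    by (auto simp: Th Tg scaleC_of_real)
  then have \<mu>\<nu>: "\<nu> = \<mu>" using unique \<mu> \<nu> by blast
  obtain w where w: "T w = \<mu> *\<^sub>R w" "w \<noteq> 0" "cinner w e1 = 0"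
  proof (cases "cinner h e1 = 0")
    case True
    then show ?thesis using Th \<open>h \<noteq> 0\<close> that[of h] by auto
  next
    case False
    define w where "w = cinner g e1 *\<^sub>C h + (- cinner h e1) *\<^sub>C g"
    have "cinner w g \<noteq> 0"
      using False g cinner_commute[of h g] gh by (simp add: w_def cinner_algebra cinner_self)
    then have "w \<noteq> 0" by auto
    moreover have "T w = \<mu> *\<^sub>R w"
      by (simp add: w_def T.add T.diff bounded_clinear_scaleC[OF selfadjoint_clinear[OF T]] Th Tg \<mu>\<nu>
          scaleC_scaleR scaleR_right_diff_distrib)
    moreover have "cinner w e1 = 0" by (simp add: w_def cinner_algebra)
    ultimately show ?thesis using that by blast
  qed
  show thesis
    by (rule that[of "w /\<^sub>R norm w" \<mu>])
      (use w le[of e1] e in \<open>simp_all add: T.scaleR cinner_scaleR_left\<close>)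
qed

section \<open>The two-factor product\<close>

definition sandwich :: "nat \<Rightarrow> nat \<Rightarrow> ('a :: chilbert_space \<Rightarrow> 'a) \<Rightarrow> ('a \<Rightarrow> 'a) \<Rightarrow> 'a \<Rightarrow> 'a" where
  "sandwich r s A B = (\<lambda>h. (B ^^ r) (A ((B ^^ s) h)) + (B ^^ s) (A ((B ^^ r) h)))"

lemma sandwich_rank_one_left:
  assumes B: "B \<in> selfadjoint_ops"
  shows "sandwich r s (rank_one x) B = sym_tensor ((B ^^ r) x) ((B ^^ s) x)"
  unfolding sandwich_def rank_one_def sym_tensor_def
  by (simp add: bounded_clinear_scaleC[OF bounded_clinear_funpow[OF selfadjoint_clinear[OF B]]]
      selfadjoint_funpow_cinner[OF B])

lemma cinner_funpow:
  assumes B: "B \<in> selfadjoint_ops"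
  shows "cinner ((B ^^ r) x) ((B ^^ s) x) = of_real ((B ^^ (r + s)) x \<bullet> x)"
proof -
  have "cinner ((B ^^ r) x) ((B ^^ s) x) = cinner ((B ^^ (r + s)) x) x"
    using selfadjoint_funpow_cinner[OF B, of s "(B ^^ r) x" x] by (simp add: funpow_add add.commute[of r])
  then show ?thesis using selfadjoint_form_real[OF selfadjoint_funpow[OF B]] by simp
qed

lemma funpow_scale_rank_one:
  assumes "norm x = 1" and "j \<ge> 1"
  shows "((\<lambda>h. c *\<^sub>R rank_one x h) ^^ j) h = c ^ j *\<^sub>R rank_one x h"
  using assms(2)
proof (induction j rule: dec_induct)
  case (step j)
  then show ?case using assms(1)
    by (simp add: rank_one_def cinner_algebra cinner_self)
      (simp add: scaleC_of_real[symmetric] mult_ac)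
qed simp

text \<open>Only \<open>u \<bullet> x\<close> matters later, so the cases \<open>s = 0\<close>, where \<open>u = A x\<close>, and \<open>s > 0\<close>, where
  \<open>u = \<langle>A x, x\<rangle> x\<close>, need not be distinguished afterwards.\<close>

lemma sandwich_rank_one_right:
  assumes A: "A \<in> selfadjoint_ops" and x: "norm x = 1" and r: "r \<ge> 1"
  obtains u where "u \<bullet> x = A x \<bullet> x" "Im (cinner u x) = 0"
    "\<And>c. sandwich r s A (\<lambda>h. c *\<^sub>R rank_one x h) = sym_tensor (c ^ (r + s) *\<^sub>R u) x"
proof (cases "s = 0")
  case True
  note lin = bounded_clinear_scaleC[OF selfadjoint_clinear[OF A]]
    linear_scale[OF bounded_linear.linear[OF selfadjoint_linear[OF A]]]
  have "sandwich r s A (\<lambda>h. c *\<^sub>R rank_one x h) = sym_tensor (c ^ (r + s) *\<^sub>R A x) x" for c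
    unfolding sandwich_def True
    by (rule ext)
      (simp only: funpow_scale_rank_one[OF x r] funpow.simps id_apply,
        simp add: rank_one_def sym_tensor_def lin selfadjoint_cinner[OF A]
        cinner_algebra scaleC_of_real[symmetric] mult_ac)
  then show thesis by (intro that[of "A x"]) (simp_all add: selfadjoint_form_real[OF A])
next
  case False
  define u where "u = (A x \<bullet> x) *\<^sub>R x"
  note lin = bounded_clinear_scaleC[OF selfadjoint_clinear[OF A]]
    linear_scale[OF bounded_linear.linear[OF selfadjoint_linear[OF A]]]
  have s: "s \<ge> 1" using False by simp
  have "sandwich r s A (\<lambda>h. c *\<^sub>R rank_one x h) = sym_tensor (c ^ (r + s) *\<^sub>R u) x" for c
    unfolding sandwich_def u_def
    by (rule ext)
      (simp only: funpow_scale_rank_one[OF x r] funpow_scale_rank_one[OF x s],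
        simp add: rank_one_def sym_tensor_def
        lin selfadjoint_form_real[OF A] cinner_algebra scaleC_of_real[symmetric] power_add mult_ac
        selfadjoint_cinner[OF A, symmetric])
  then show thesis
    by (intro that[of u]) (use x in \<open>simp_all add: u_def cinner_algebra cinner_self power2_norm_eq_inner[symmetric]\<close>)
qed

lemma selfadjoint_sandwich:
  assumes A: "A \<in> selfadjoint_ops" and B: "B \<in> selfadjoint_ops"
  shows "sandwich r s A B \<in> selfadjoint_ops"
  unfolding selfadjoint_ops_iff sandwich_def
  by (auto intro!: bounded_clinear_add bounded_clinear_compose[OF bounded_clinear_funpow]
      bounded_clinear_compose[OF selfadjoint_clinear[OF A]] bounded_clinear_funpow
      selfadjoint_clinear[OF B]
      simp: cinner_algebra selfadjoint_funpow_cinner[OF B] selfadjoint_cinner[OF A])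

lemma sandwich_form:
  assumes A: "A \<in> selfadjoint_ops" and B: "B \<in> selfadjoint_ops"
  shows "sandwich r s A B h \<bullet> h = 2 * (A ((B ^^ s) h) \<bullet> (B ^^ r) h)"
  using selfadjoint_inner[OF selfadjoint_funpow[OF B]] selfadjoint_inner[OF A]
  by (simp add: sandwich_def inner_add_left) (metis inner_commute)

section \<open>Compressions to planes\<close>

text \<open>A Hermitian \<open>2 \<times> 2\<close> matrix with entries \<open>g\<close>, \<open>b\<close>, \<open>d\<close> is diagonalized by the orthogonal vectors
  \<open>\<tau> e + f\<close> and \<open>- e + cnj \<tau> f\<close>, where \<open>\<tau> = m / b\<close> and \<open>m\<close> is a root of
  \<open>m\<^sup>2 - (g - d) m - \<bar>b\<bar>\<^sup>2\<close>. Invertibility makes the diagonal entries non-zero.\<close>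

lemma diagonalize_plane:
  fixes C :: "'a :: chilbert_space \<Rightarrow> 'a"
  assumes C: "C \<in> selfadjoint_ops" and e: "norm e = 1" "norm f = 1" "cinner e f = 0"
    and det: "(C e \<bullet> e) * (C f \<bullet> f) \<noteq> (cmod (cinner (C e) f))\<^sup>2"
  obtains e1 e2 where "norm e1 = 1" "norm e2 = 1" "cinner e1 e2 = 0" "cinner (C e1) e2 = 0"
    "C e1 \<bullet> e1 \<noteq> 0" "C e2 \<bullet> e2 \<noteq> 0"
proof -
  define b where "b = cinner (C e) f"
  define B where "B = (cmod b)\<^sup>2"
  define g where "g = C e \<bullet> e"
  define d where "d = C f \<bullet> f"
  have det': "g * d - B \<noteq> 0" using det by (simp add: b_def B_def g_def d_def)
  show thesis
  proof (cases "b = 0")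
    case True
    then show thesis using that[of e f] e det' by (simp add: b_def B_def g_def d_def)
  next
    case False
    define m where "m = ((g - d) + sqrt ((g - d)\<^sup>2 + 4 * B)) / 2"
    have B0: "B > 0" using False by (simp add: B_def)
    have "2 * m - (g - d) = sqrt ((g - d)\<^sup>2 + 4 * B)" by (simp add: m_def field_simps)
    then have "(2 * m - (g - d))\<^sup>2 = (g - d)\<^sup>2 + 4 * B" using B0 by simp
    then have m: "m\<^sup>2 - (g - d) * m - B = 0" by (simp add: power2_eq_square algebra_simps)
    define \<tau> where "\<tau> = of_real m / b"
    have \<tau>b: "\<tau> * b = of_real m" using False by (simp add: \<tau>_def)
    have bb: "b * cnj b = of_real B" unfolding B_def by (metis complex_norm_square of_real_power)
    have \<tau>\<tau>: "\<tau> * cnj \<tau> = of_real (m\<^sup>2 / B)"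
      using bb by (simp add: \<tau>_def power2_eq_square)
    define e1 where "e1 = \<tau> *\<^sub>C e + f"
    define e2 where "e2 = cnj \<tau> *\<^sub>C f - e"
    interpret C: bounded_linear C by (rule selfadjoint_linear[OF C])
    note CC = bounded_clinear_scaleC[OF selfadjoint_clinear[OF C]]
    have ee: "cinner e e = 1" "cinner f f = 1" "cinner f e = 0"
      using e cinner_commute[of f e] by (simp_all add: cinner_self)
    have Ce: "cinner (C e) e = of_real g" "cinner (C f) f = of_real d" "cinner (C e) f = b"
      by (simp_all add: g_def d_def b_def selfadjoint_form_real[OF C])
    have Cf: "cinner (C f) e = cnj b"
      unfolding b_def by (metis cinner_commute selfadjoint_cinner[OF C])
    have n1: "cinner e1 e1 = of_real (1 + m\<^sup>2 / B)" and n2: "cinner e2 e2 = of_real (1 + m\<^sup>2 / B)"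
      using \<tau>\<tau> by (simp_all add: e1_def e2_def cinner_algebra ee e mult.commute)
    have orth: "cinner e1 e2 = 0" by (simp add: e1_def e2_def cinner_algebra ee e)
    have "b * cinner (C e1) e2 = (\<tau> * b)\<^sup>2 - (g - d) * (\<tau> * b) - b * cnj b"
      by (simp add: e1_def e2_def cinner_algebra C.add CC Ce Cf algebra_simps power2_eq_square)
    also have "\<dots> = of_real (m\<^sup>2 - (g - d) * m - B)" by (simp add: \<tau>b bb)
    finally have Corth: "cinner (C e1) e2 = 0" using False m by simp
    have "cinner (C e1) e1 = \<tau> * cnj \<tau> * g + \<tau> * b + cnj (\<tau> * b) + d"
      by (simp add: e1_def cinner_algebra C.add CC Ce Cf algebra_simps)
    then have "cinner (C e1) e1 = of_real (m\<^sup>2 / B * g + 2 * m + d)" by (simp add: \<tau>\<tau> \<tau>b)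
    then have c1: "C e1 \<bullet> e1 = m\<^sup>2 / B * g + 2 * m + d" by (metis Re_complex_of_real Re_cinner)
    have "cinner (C e2) e2 = \<tau> * cnj \<tau> * d - \<tau> * b - cnj (\<tau> * b) + g"
      by (simp add: e2_def cinner_algebra C.diff CC Ce Cf algebra_simps)
    then have "cinner (C e2) e2 = of_real (m\<^sup>2 / B * d - 2 * m + g)" by (simp add: \<tau>\<tau> \<tau>b)
    then have c2: "C e2 \<bullet> e2 = m\<^sup>2 / B * d - 2 * m + g" by (metis Re_complex_of_real Re_cinner)
    \<comment> \<open>The determinant of the matrix in the new basis.\<close>
    have "(m\<^sup>2 * g + 2 * m * B + d * B) * (m\<^sup>2 * d - 2 * m * B + g * B)
        = (g * d - B) * (B + m\<^sup>2)\<^sup>2 + B * (m\<^sup>2 - (g - d) * m - B)\<^sup>2"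
      by (simp add: power2_eq_square algebra_simps)
    also have "\<dots> = (g * d - B) * (B + m\<^sup>2)\<^sup>2" using m by simp
    also have "\<dots> \<noteq> 0" using det' B0 by (simp add: add_pos_nonneg less_imp_neq[symmetric])
    finally have "m\<^sup>2 * g + 2 * m * B + d * B \<noteq> 0" "m\<^sup>2 * d - 2 * m * B + g * B \<noteq> 0"
      by (metis mult_zero_left, metis mult_zero_right)
    moreover have "(C e1 \<bullet> e1) * B = m\<^sup>2 * g + 2 * m * B + d * B"
      "(C e2 \<bullet> e2) * B = m\<^sup>2 * d - 2 * m * B + g * B"
      unfolding c1 c2 using B0 by (simp_all add: field_simps)
    ultimately have nz: "C e1 \<bullet> e1 \<noteq> 0" "C e2 \<bullet> e2 \<noteq> 0" by (metis mult_zero_left)+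
    then have "e1 \<noteq> 0" "e2 \<noteq> 0" by auto
    then show thesis
      using that[of "e1 /\<^sub>R norm e1" "e2 /\<^sub>R norm e2"] nz orth Corth
      by (simp add: cinner_algebra C.scaleR)
  qed
qed

text \<open>If every compression of \<open>C\<close> to a plane containing \<open>e\<close> is singular, then the form of
  \<open>\<langle>C e, e\<rangle> C - C e \<otimes> C e\<close> vanishes.\<close>

lemma rank_one_or_plane:
  fixes C :: "'a :: chilbert_space \<Rightarrow> 'a"
  assumes C: "C \<in> selfadjoint_ops" and "C \<noteq> (\<lambda>x. 0)"
  obtains (rank_one) c y where "norm y = 1" "C = (\<lambda>h. c *\<^sub>R rank_one y h)"
  | (plane) e1 e2 where "norm e1 = 1" "norm e2 = 1" "cinner e1 e2 = 0" "cinner (C e1) e2 = 0"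
    "C e1 \<bullet> e1 \<noteq> 0" "C e2 \<bullet> e2 \<noteq> 0"
proof -
  interpret C: bounded_linear C by (rule selfadjoint_linear[OF C])
  obtain z where z: "C z \<bullet> z \<noteq> 0"
    using selfadjoint_eqI[OF C selfadjoint_zero] assms(2) by auto
  then have "z \<noteq> 0" by auto
  define e where "e = z /\<^sub>R norm z"
  define g where "g = C e \<bullet> e"
  have e: "norm e = 1" using \<open>z \<noteq> 0\<close> by (simp add: e_def)
  have g: "g \<noteq> 0" using z \<open>z \<noteq> 0\<close> by (simp add: g_def e_def C.scaleR)
  show thesis
  proof (cases "\<exists>f. norm f = 1 \<and> cinner e f = 0 \<and> g * (C f \<bullet> f) \<noteq> (cmod (cinner (C e) f))\<^sup>2")
    case True
    then obtain f where "norm f = 1" "cinner e f = 0" "g * (C f \<bullet> f) \<noteq> (cmod (cinner (C e) f))\<^sup>2"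
      by blast
    from diagonalize_plane[OF C e this(1,2) this(3)[unfolded g_def]] plane show thesis by blast
  next
    case False
    then have singular: "g * (C f \<bullet> f) = (cmod (cinner (C e) f))\<^sup>2"
      if "cinner e f = 0" "norm f = 1" for f using that by blast
    define G where "G = (\<lambda>h. g *\<^sub>R C h - rank_one (C e) h)"
    have G: "G \<in> selfadjoint_ops"
      unfolding G_def by (intro selfadjoint_diff selfadjoint_scaleR C selfadjoint_rank_one)
    interpret G: bounded_linear G by (rule selfadjoint_linear[OF G])
    have Ge: "G e = 0"
      using selfadjoint_form_real[OF C, of e] selfadjoint_cinner[OF C, of e e]
      by (simp add: G_def rank_one_def g_def scaleC_of_real)
    have perp: "G f \<bullet> f = 0" if f: "cinner e f = 0" for f
    proof (cases "f = 0")
      case False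
      have "g * (C (f /\<^sub>R norm f) \<bullet> (f /\<^sub>R norm f)) = (cmod (cinner (C e) (f /\<^sub>R norm f)))\<^sup>2"
        by (intro singular) (use f False in \<open>simp_all add: cinner_algebra\<close>)
      then have "g * (C f \<bullet> f) = (cmod (cinner (C e) f))\<^sup>2"
        using False by (simp add: C.scaleR cinner_algebra norm_mult norm_divide power_mult_distrib field_simps power2_eq_square)
      moreover have "cmod (cinner (C e) f) = cmod (cinner f (C e))"
        by (metis cinner_commute complex_mod_cnj)
      ultimately show ?thesis by (simp add: G_def inner_diff_left rank_one_form)
    qed (simp add: G.zero)
    have "G h \<bullet> h = 0" for h
    proof -
      define f where "f = h - cinner h e *\<^sub>C e"
      have Gh: "G f = G h"
        by (simp add: f_def G.diff bounded_clinear_scaleC[OF selfadjoint_clinear[OF G]] Ge)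
      have "cinner f e = 0" using e by (simp add: f_def cinner_algebra cinner_self)
      then have "G f \<bullet> f = 0" using perp cinner_commute[of e f] by simp
      then have "G f \<bullet> h = 0"
        using selfadjoint_inner[OF G, of f f] selfadjoint_inner[OF G, of f h] Gh by simp
      then show ?thesis using Gh by simp
    qed
    then have "G = (\<lambda>h. 0)" by (intro selfadjoint_eqI[OF G selfadjoint_zero]) simp
    then have CG: "g *\<^sub>R C h = rank_one (C e) h" for h by (simp add: G_def fun_eq_iff)
    have Ce: "C e \<noteq> 0" using g by (auto simp: g_def)
    have "C = (\<lambda>h. ((norm (C e))\<^sup>2 / g) *\<^sub>R rank_one (C e /\<^sub>R norm (C e)) h)"
    proof
      fix h
      have "C h = inverse g *\<^sub>R rank_one (C e) h" using g by (simp add: CG[symmetric])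
      also have "\<dots> = ((norm (C e))\<^sup>2 / g) *\<^sub>R rank_one (C e /\<^sub>R norm (C e)) h"
        using Ce g
        by (simp add: rank_one_def cinner_algebra scaleC_of_real[symmetric] power2_eq_square field_simps)
      finally show "C h = ((norm (C e))\<^sup>2 / g) *\<^sub>R rank_one (C e /\<^sub>R norm (C e)) h" .
    qed
    with Ce show thesis by (intro rank_one[of "C e /\<^sub>R norm (C e)" "(norm (C e))\<^sup>2 / g"]) auto
  qed
qed

section \<open>Images of rank-one projections\<close>

text \<open>Putting one operator at the distinguished position of the generalized Jordan product and a
  common second one at all other positions leaves a product of two factors, with \<open>r\<close> and \<open>s\<close>
  repetitions of the second one on the two sides.\<close>

locale spectrum_preserver =
  fixes \<Phi> :: "('a :: chilbert_space \<Rightarrow> 'a) \<Rightarrow> ('b :: chilbert_space \<Rightarrow> 'b)" and r s :: nat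
  assumes r: "r \<ge> 1"
    and maps_selfadjoint: "A \<in> selfadjoint_ops \<Longrightarrow> \<Phi> A \<in> selfadjoint_ops"
    and spectrum_eq: "\<lbrakk>A \<in> selfadjoint_ops; B \<in> selfadjoint_ops; op_rank A \<le> 1 \<or> op_rank B \<le> 1\<rbrakk>
      \<Longrightarrow> spectrum (sandwich r s (\<Phi> A) (\<Phi> B)) = spectrum (sandwich r s A B)"
    and range_rank_three: "\<lbrakk>D \<in> selfadjoint_ops; op_rank D \<le> 3\<rbrakk> \<Longrightarrow> D \<in> \<Phi> ` selfadjoint_ops"
begin

lemma range_rank_one: "(\<lambda>h. c *\<^sub>R rank_one y h) \<in> \<Phi> ` selfadjoint_ops"
proof (rule range_rank_three[OF selfadjoint_scaleR[OF selfadjoint_rank_one]])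
  have "(1 :: enat) \<le> 3" by (simp add: one_enat_def numeral_eq_enat)
  with op_rank_scale_rank_one show "op_rank (\<lambda>h. c *\<^sub>R rank_one y h) \<le> 3" by (rule order_trans)
qed

lemma spectrum_image_rank_one:
  assumes "B \<in> selfadjoint_ops"
  shows "spectrum (sandwich r s (\<Phi> (rank_one x)) (\<Phi> B))
    = spectrum (sym_tensor ((B ^^ r) x) ((B ^^ s) x))"
  using spectrum_eq[OF selfadjoint_rank_one assms, of x] op_rank_rank_one[of x]
  by (simp add: sandwich_rank_one_left[OF assms])

text \<open>Both products are symmetrized rank-one tensors, whose spectrum determines the trace.\<close>

lemma form_eq_if_image_rank_one:
  assumes A: "A \<in> selfadjoint_ops" and \<Phi>x: "\<Phi> (rank_one x) = (\<lambda>h. c *\<^sub>R rank_one y h)"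
    and x: "norm x = 1" and y: "norm y = 1"
  shows "A x \<bullet> x = c ^ (r + s) * (\<Phi> A y \<bullet> y)"
proof -
  obtain u where u: "u \<bullet> x = A x \<bullet> x" "Im (cinner u x) = 0"
    and su: "sandwich r s A (\<lambda>h. 1 *\<^sub>R rank_one x h) = sym_tensor (1 ^ (r + s) *\<^sub>R u) x"
    using sandwich_rank_one_right[OF A x r] by metis
  obtain v where v: "v \<bullet> y = \<Phi> A y \<bullet> y" "Im (cinner v y) = 0"
    and sv: "sandwich r s (\<Phi> A) (\<lambda>h. c *\<^sub>R rank_one y h) = sym_tensor (c ^ (r + s) *\<^sub>R v) y"
    using sandwich_rank_one_right[OF maps_selfadjoint[OF A] y r] by metis
  have "spectrum (sym_tensor u x) = spectrum (sym_tensor (c ^ (r + s) *\<^sub>R v) y)"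
    using spectrum_eq[OF A selfadjoint_rank_one, of x] op_rank_rank_one[of x] su sv by (simp add: \<Phi>x)
  from inner_determined_by_spectrum[OF u(2) _ this] show ?thesis
    using u v by (simp add: cinner_algebra flip: of_real_power)
qed

text \<open>For even \<open>r + s\<close>, the trace of the product of a rank-one projection with powers of \<open>B\<close> is
  \<open>2 \<langle>(B ^^ (r + s)) x, x\<rangle> \<ge> 0\<close>. Probing the image with rank-one projections transfers this sign.\<close>

lemma image_rank_one_form_nonneg:
  assumes "even (r + s)"
  shows "\<Phi> (rank_one x) y \<bullet> y \<ge> 0"
proof (cases "y = 0")
  case False
  define y' where "y' = y /\<^sub>R norm y"
  define C where "C = \<Phi> (rank_one x)"
  have C: "C \<in> selfadjoint_ops" unfolding C_def by (rule maps_selfadjoint[OF selfadjoint_rank_one])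
  have y': "norm y' = 1" using False by (simp add: y'_def)
  obtain B where B: "B \<in> selfadjoint_ops" "\<Phi> B = (\<lambda>h. 1 *\<^sub>R rank_one y' h)"
    using range_rank_one[of 1 y'] by auto
  obtain v where v: "v \<bullet> y' = C y' \<bullet> y'" "Im (cinner v y') = 0"
    and sv: "sandwich r s C (\<lambda>h. 1 *\<^sub>R rank_one y' h) = sym_tensor (1 ^ (r + s) *\<^sub>R v) y'"
    using sandwich_rank_one_right[OF C y' r] by metis
  have Bx: "cinner ((B ^^ r) x) ((B ^^ s) x) = of_real ((B ^^ (r + s)) x \<bullet> x)"
    by (rule cinner_funpow[OF B(1)])
  have "spectrum (sym_tensor v y') = spectrum (sym_tensor ((B ^^ r) x) ((B ^^ s) x))"
    using spectrum_image_rank_one[OF B(1), of x] sv by (simp add: B(2) C_def)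
  from inner_determined_by_spectrum[OF v(2) _ this]
  have "C y' \<bullet> y' = (B ^^ r) x \<bullet> (B ^^ s) x" using Bx v by simp
  also have "\<dots> = (B ^^ (r + s)) x \<bullet> x" by (metis Bx Re_cinner Re_complex_of_real)
  also have "(B ^^ (r + s)) x \<bullet> x = (B ^^ ((r + s) div 2)) x \<bullet> (B ^^ ((r + s) div 2)) x"
  proof -
    have "r + s = (r + s) div 2 + (r + s) div 2" using assms by presburger
    then have "(B ^^ (r + s)) x = (B ^^ ((r + s) div 2)) ((B ^^ ((r + s) div 2)) x)"
      by (metis comp_apply funpow_add)
    then show ?thesis using selfadjoint_inner[OF selfadjoint_funpow[OF B(1)]] by simp
  qed
  finally have "C y' \<bullet> y' \<ge> 0" by simp
  then have "C (norm y *\<^sub>R y') \<bullet> (norm y *\<^sub>R y') \<ge> 0"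
    by (simp add: linear_scale[OF bounded_linear.linear[OF selfadjoint_linear[OF C]]])
  moreover have "norm y *\<^sub>R y' = y" using False by (simp add: y'_def)
  ultimately show ?thesis by (simp add: C_def)
qed simp

text \<open>Suppose the image \<open>C\<close> of a rank-one projection has an invertible compression to a plane, which
  may be taken diagonal with entries \<open>c1, c2\<close>. Probe \<open>C\<close> with \<open>D = \<plusminus> e1 \<otimes> e1 \<plusminus> \<delta> (e2 \<otimes> e2)\<close>. The
  product has a form that is positive on the plane, and since it has the spectrum of a
  \<^const>\<open>sym_tensor\<close>, it has one positive eigenvalue only. An eigenvector orthogonal to \<open>e1\<close> shows that
  this eigenvalue is \<open>O(\<delta>)\<close>; the vector \<open>e1\<close> shows that it is at least \<open>2 \<bar>c1\<bar>\<close>.\<close>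

lemma image_rank_one_no_plane:
  assumes e: "norm e1 = 1" "norm e2 = 1" "cinner e1 e2 = 0" and Ce: "cinner (\<Phi> (rank_one x) e1) e2 = 0"
    and nz: "\<Phi> (rank_one x) e1 \<bullet> e1 \<noteq> 0" "\<Phi> (rank_one x) e2 \<bullet> e2 \<noteq> 0"
  shows False
proof -
  define C where "C = \<Phi> (rank_one x)"
  define c1 where "c1 = C e1 \<bullet> e1"
  define c2 where "c2 = C e2 \<bullet> e2"
  have C: "C \<in> selfadjoint_ops" unfolding C_def by (rule maps_selfadjoint[OF selfadjoint_rank_one])
  interpret C: bounded_linear C by (rule selfadjoint_linear[OF C])
  note CC = bounded_clinear_scaleC[OF selfadjoint_clinear[OF C]]
  have c0: "c1 \<noteq> 0" "c2 \<noteq> 0" using nz by (simp_all add: c1_def c2_def C_def)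
  \<comment> \<open>Odd powers keep the sign of the weights of \<open>D\<close>, which can thus be matched to \<open>c1\<close> and \<open>c2\<close>;
    even powers lose it, but then \<open>C\<close> is positive.\<close>
  have sgn: "sgn c ^ (r + s) * c = \<bar>c\<bar>" if "c = c1 \<or> c = c2" for c
  proof (cases "even (r + s)")
    case True
    then have "c \<ge> 0" using that image_rank_one_form_nonneg by (auto simp: c1_def c2_def C_def)
    then show ?thesis using c0 that by (auto simp: sgn_if)
  next
    case False
    then show ?thesis using c0 that by (auto simp: sgn_if)
  qed
  \<comment> \<open>Small enough for the two bounds on the eigenvalue to contradict each other.\<close>
  define \<delta> where "\<delta> = \<bar>c1\<bar> / (\<bar>c1\<bar> + norm (C e2) + 1)"
  have den: "\<bar>c1\<bar> + norm (C e2) + 1 > 0" by (simp add: add_nonneg_pos)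
  have \<delta>: "\<delta> > 0" "\<delta> \<le> 1" "\<delta> * norm (C e2) < \<bar>c1\<bar>"
  proof -
    show "\<delta> > 0" "\<delta> \<le> 1" using c0 den by (simp_all add: \<delta>_def)
    have "\<bar>c1\<bar> * norm (C e2) < \<bar>c1\<bar> * (\<bar>c1\<bar> + norm (C e2) + 1)"
      using c0 by (intro mult_strict_left_mono) auto
    then show "\<delta> * norm (C e2) < \<bar>c1\<bar>" using den by (simp add: \<delta>_def field_simps)
  qed
  define t1 where "t1 = sgn c1"
  define t2 where "t2 = \<delta> * sgn c2"
  have t1: "t1 ^ (r + s) * c1 = \<bar>c1\<bar>" using sgn[of c1] by (simp add: t1_def)
  have "t2 ^ (r + s) * c2 = \<delta> ^ (r + s) * (sgn c2 ^ (r + s) * c2)"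
    by (simp add: t2_def power_mult_distrib)
  then have t2: "t2 ^ (r + s) * c2 > 0" using sgn[of c2] \<delta> c0 by simp
  have at2: "\<bar>t2\<bar> = \<delta>" using \<delta> c0 by (simp add: t2_def abs_mult abs_sgn_eq)
  define D where "D = (\<lambda>h. t1 *\<^sub>R rank_one e1 h + t2 *\<^sub>R rank_one e2 h)"
  have D: "D \<in> selfadjoint_ops"
    unfolding D_def by (intro selfadjoint_add selfadjoint_scaleR selfadjoint_rank_one)
  have ee: "cinner e1 e1 = 1" "cinner e2 e2 = 1" "cinner e2 e1 = 0"
    using e cinner_commute[of e2 e1] by (simp_all add: cinner_self)
  have De: "D e1 = t1 *\<^sub>R e1" "D e2 = t2 *\<^sub>R e2"
    using ee e by (simp_all add: D_def rank_one_def)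
  note Dlin = linear_scale[OF bounded_linear.linear[OF selfadjoint_linear[OF D]]]
    linear_add[OF bounded_linear.linear[OF selfadjoint_linear[OF D]]]
    bounded_clinear_scaleC[OF selfadjoint_clinear[OF D]]
  have Dpow: "(D ^^ j) (a *\<^sub>C e1 + b *\<^sub>C e2)
      = (t1 ^ j) *\<^sub>R (a *\<^sub>C e1) + (t2 ^ j) *\<^sub>R (b *\<^sub>C e2)" for j a b
    by (induction j) (simp_all add: Dlin De scaleC_scaleR mult.commute)
  have Dperp: "(D ^^ j) h = t2 ^ j *\<^sub>R (cinner h e2 *\<^sub>C e2)" if "cinner h e1 = 0" "j \<ge> 1" for j h
  proof -
    have "(D ^^ j) h = (D ^^ (j - 1)) (D h)"
      using that(2) by (cases j) (simp_all add: funpow_swap1)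
    also have "D h = 0 *\<^sub>C e1 + (of_real t2 * cinner h e2) *\<^sub>C e2"
      using that(1) by (simp add: D_def rank_one_def scaleC_of_real[symmetric])
    also have "(D ^^ (j - 1)) \<dots> = t2 ^ j *\<^sub>R (cinner h e2 *\<^sub>C e2)"
      using that(2) unfolding Dpow by (cases j) (simp_all add: scaleC_of_real[symmetric] mult_ac)
    finally show ?thesis .
  qed
  have "compact_op D"
    unfolding D_def by (intro compact_op_add compact_op_scaleR compact_op_rank_one)
  then have Dr: "compact_op (D ^^ r)"
    using compact_op_compose_left[of "D ^^ (r - 1)" D] r selfadjoint_linear[OF selfadjoint_funpow[OF D]]
    by (cases r) (simp_all add: funpow_Suc_right o_def del: funpow.simps(2))
  define T where "T = sandwich r s C D"
  have T: "T \<in> selfadjoint_ops" unfolding T_def by (rule selfadjoint_sandwich[OF C D])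
  have T_compact: "compact_op T"
    unfolding T_def sandwich_def
  proof (rule compact_op_add)
    note pow = selfadjoint_linear[OF selfadjoint_funpow[OF D]]
    show "compact_op (\<lambda>h. (D ^^ r) (C ((D ^^ s) h)))"
      by (rule compact_op_compose_right[OF bounded_linear_compose[OF C.bounded_linear_axioms pow] Dr])
    show "compact_op (\<lambda>h. (D ^^ s) (C ((D ^^ r) h)))"
      by (rule compact_op_compose_left[OF bounded_linear_compose[OF pow C.bounded_linear_axioms] Dr])
  qed
  have T_form: "T (a *\<^sub>C e1 + b *\<^sub>C e2) \<bullet> (a *\<^sub>C e1 + b *\<^sub>C e2)
      = 2 * ((cmod a)\<^sup>2 * (t1 ^ (r + s) * c1) + (cmod b)\<^sup>2 * (t2 ^ (r + s) * c2))" for a b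
  proof -
    have C1: "cinner (C e1) e1 = of_real c1" "cinner (C e2) e2 = of_real c2"
      by (simp_all add: c1_def c2_def selfadjoint_form_real[OF C])
    have C2: "cinner (C e1) e2 = 0" "cinner (C e2) e1 = 0"
      using Ce cinner_commute[of "C e2" e1] selfadjoint_cinner[OF C, of e1 e2] by (simp_all add: C_def)
    have "cinner (C ((D ^^ s) (a *\<^sub>C e1 + b *\<^sub>C e2))) ((D ^^ r) (a *\<^sub>C e1 + b *\<^sub>C e2))
      = (a * cnj a) * of_real (t1 ^ (r + s) * c1) + (b * cnj b) * of_real (t2 ^ (r + s) * c2)"
      unfolding Dpow by (simp add: C.add C.scaleR CC cinner_algebra C1 C2 power_add mult_ac)
    also have "\<dots> = of_real ((cmod a)\<^sup>2 * (t1 ^ (r + s) * c1) + (cmod b)\<^sup>2 * (t2 ^ (r + s) * c2))"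
      by (simp only: of_real_add of_real_mult complex_norm_square)
    finally have "C ((D ^^ s) (a *\<^sub>C e1 + b *\<^sub>C e2)) \<bullet> (D ^^ r) (a *\<^sub>C e1 + b *\<^sub>C e2)
      = (cmod a)\<^sup>2 * (t1 ^ (r + s) * c1) + (cmod b)\<^sup>2 * (t2 ^ (r + s) * c2)"
      by (metis Re_cinner Re_complex_of_real)
    then show ?thesis unfolding T_def sandwich_form[OF C D] by simp
  qed
  have T_pos: "T (a *\<^sub>C e1 + b *\<^sub>C e2) \<bullet> (a *\<^sub>C e1 + b *\<^sub>C e2) > 0"
    if "a *\<^sub>C e1 + b *\<^sub>C e2 \<noteq> 0" for a b
  proof -
    have "a \<noteq> 0 \<or> b \<noteq> 0" using that by auto
    then show ?thesis unfolding T_form t1 using t2 c0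
      by (auto intro: add_pos_nonneg add_nonneg_pos)
  qed
  obtain B where B: "B \<in> selfadjoint_ops" "\<Phi> B = D"
    using range_rank_three[OF D] op_rank_two[of t1 e1 t2 e2] by (auto simp: D_def)
  have spec: "spectrum T = spectrum (sym_tensor ((B ^^ r) x) ((B ^^ s) x))"
    using spectrum_image_rank_one[OF B(1), of x] by (simp add: T_def C_def B(2))
  have real: "Im (cinner ((B ^^ r) x) ((B ^^ s) x)) = 0" by (simp add: cinner_funpow[OF B(1)])
  obtain \<mu> h where Th: "T h = \<mu> *\<^sub>R h" and h: "norm h = 1" "cinner h e1 = 0" and le: "T e1 \<bullet> e1 \<le> \<mu>"
    using eigenvector_in_hyperplane[OF T T_compact T_pos e]
      positive_spectral_value_unique[OF real] unfolding spec by metis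
  have "2 * \<bar>c1\<bar> \<le> \<mu>" using le T_form[of 1 0] t1 by simp
  also have "\<mu> = T h \<bullet> h" using h by (simp add: Th power2_norm_eq_inner[symmetric])
  also have "\<dots> = 2 * ((D ^^ s) h \<bullet> C ((D ^^ r) h))"
    unfolding T_def sandwich_form[OF C D] using selfadjoint_inner[OF C] by simp
  also have "\<dots> \<le> 2 * (\<delta> * norm (C e2))"
  proof -
    have he2: "cmod (cinner h e2) \<le> 1" using norm_cinner_le[of h e2] h e by simp
    have pow: "\<delta> ^ j * cmod (cinner h e2) \<le> \<delta>" if "j \<ge> 1" for j
    proof -
      have "\<delta> ^ j \<le> \<delta> ^ 1" using that \<delta> by (intro power_decreasing) auto
      then show ?thesis using mult_mono[of "\<delta> ^ j" \<delta> "cmod (cinner h e2)" 1] he2 \<delta> by simp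
    qed
    have "norm ((D ^^ s) h) \<le> 1"
    proof (cases "s = 0")
      case False
      then have "norm ((D ^^ s) h) = \<delta> ^ s * cmod (cinner h e2)"
        using Dperp[OF h(2), of s] e by (simp add: norm_scaleC power_abs at2)
      then show ?thesis using pow[of s] False \<delta> by simp
    qed (use h in simp)
    moreover have "norm (C ((D ^^ r) h)) = \<delta> ^ r * cmod (cinner h e2) * norm (C e2)"
      using Dperp[OF h(2) r] by (simp add: C.scaleR CC norm_scaleC power_abs at2)
    then have "norm (C ((D ^^ r) h)) \<le> \<delta> * norm (C e2)"
      using mult_right_mono[OF pow[OF r], of "norm (C e2)"] by simp
    ultimately have "norm ((D ^^ s) h) * norm (C ((D ^^ r) h)) \<le> 1 * (\<delta> * norm (C e2))"
      by (intro mult_mono) auto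
    then show ?thesis using norm_cauchy_schwarz[of "(D ^^ s) h" "C ((D ^^ r) h)"] by simp
  qed
  finally show False using \<delta> by simp
qed

text \<open>The value of the scalar comes from pairing the projection with itself.\<close>

lemma image_rank_one:
  assumes x: "norm x = 1"
  obtains c y where "norm y = 1" "c \<in> {-1, 1}" "c ^ (r + s + 1) = 1"
    "\<Phi> (rank_one x) = (\<lambda>h. c *\<^sub>R rank_one y h)"
proof -
  define C where "C = \<Phi> (rank_one x)"
  have C: "C \<in> selfadjoint_ops" unfolding C_def by (rule maps_selfadjoint[OF selfadjoint_rank_one])
  have "C \<noteq> (\<lambda>x. 0)"
  proof
    assume C0: "C = (\<lambda>x. 0)"
    have z: "(C ^^ j) 0 = 0" for j by (induction j) (simp_all add: C0)
    have "sandwich r s C C = sym_tensor 0 0" by (simp add: sandwich_def sym_tensor_def z C0[THEN fun_cong] fun_eq_iff)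
    then have "spectrum (sym_tensor (0::'b) 0)
        = spectrum (sym_tensor ((rank_one x ^^ r) x) ((rank_one x ^^ s) x))"
      using spectrum_image_rank_one[OF selfadjoint_rank_one, of x x] by (simp add: C_def)
    moreover have "(rank_one x ^^ j) x = x" for j
      using x by (induction j) (simp_all add: rank_one_def cinner_self)
    ultimately have "(0::'b) \<bullet> 0 = x \<bullet> x"
      by (intro inner_determined_by_spectrum) (simp_all add: cinner_self)
    then show False using x by (simp add: power2_norm_eq_inner[symmetric])
  qed
  from C this obtain c y where y: "norm y = 1" and cy: "C = (\<lambda>h. c *\<^sub>R rank_one y h)"
  proof (cases rule: rank_one_or_plane)
    case (plane e1 e2)
    then show ?thesis using image_rank_one_no_plane[of e1 e2 x] by (simp add: C_def)
  qed
  have "rank_one x x \<bullet> x = c ^ (r + s) * (C y \<bullet> y)"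
    unfolding C_def
    by (rule form_eq_if_image_rank_one[OF selfadjoint_rank_one _ x y]) (use cy in \<open>simp add: C_def\<close>)
  then have c: "c ^ (r + s + 1) = 1"
    using x y by (simp add: cy rank_one_form cinner_self mult.commute)
  then have "\<bar>c\<bar> ^ Suc (r + s) = 1 ^ Suc (r + s)" by (metis Suc_eq_plus1 abs_one power_abs power_one)
  then have "\<bar>c\<bar> = 1" by (rule power_inject_base) auto
  then show thesis using that[OF y _ c] cy by (auto simp: C_def abs_if split: if_splits)
qed

end

section \<open>Wigner's theorem\<close>

lemma inner_isometry_additive:
  fixes W :: "'a :: real_inner \<Rightarrow> 'b :: real_inner"
  assumes "\<And>x y. W x \<bullet> W y = x \<bullet> y"
  shows "W (x + y) = W x + W y"
proof -
  have "(norm (W (x + y) - (W x + W y)))\<^sup>2 = 0"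
    unfolding power2_norm_eq_inner
    by (simp add: inner_diff_left inner_diff_right inner_add_left inner_add_right assms)
  then show ?thesis by simp
qed

text \<open>Linearity up to conjugation is automatic: the defect has inner square zero.\<close>

lemma semi_isometry:
  fixes W :: "'a :: chilbert_space \<Rightarrow> 'b :: chilbert_space"
  assumes \<kappa>: "\<kappa> = (\<lambda>c. c) \<or> \<kappa> = cnj" and W: "\<And>x y. cinner (W x) (W y) = \<kappa> (cinner x y)"
  shows "W x \<bullet> W y = x \<bullet> y" and "norm (W x) = norm x" and "W (x + y) = W x + W y"
    and "W (c *\<^sub>C x) = \<kappa> c *\<^sub>C W x"
proof -
  show inner: "W x \<bullet> W y = x \<bullet> y" for x y
    using \<kappa> W[of x y] by (auto simp: Re_cinner[symmetric])
  then show "norm (W x) = norm x" by (simp add: norm_eq_sqrt_inner)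
  show "W (x + y) = W x + W y" by (rule inner_isometry_additive[OF inner])
  have "cinner (W (c *\<^sub>C x) - \<kappa> c *\<^sub>C W x) (W (c *\<^sub>C x) - \<kappa> c *\<^sub>C W x) = 0"
    using \<kappa> by (auto simp: W cinner_algebra algebra_simps)
  then show "W (c *\<^sub>C x) = \<kappa> c *\<^sub>C W x" by (simp add: cinner_self)
qed

text \<open>Wigner's theorem without surjectivity. Fix a unit vector \<open>e\<close> with image \<open>f\<close> and normalize the
  image of \<open>e + x\<close>, for \<open>x\<close> orthogonal to \<open>e\<close>, to \<open>f + U x\<close>. Then \<open>\<bar>1 + \<langle>x, y\<rangle>\<bar> = \<bar>1 + \<langle>U x, U y\<rangle>\<bar>\<close>;
  scaling \<open>x\<close> shows that \<open>U\<close> preserves both the real part and the modulus of the inner product.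
  So \<open>U\<close> is real-linear and maps \<open>\<i> x\<close> to \<open>\<plusminus> \<i> U x\<close>, with one sign for all \<open>x\<close> by additivity.\<close>

theorem wigner:
  fixes Y :: "'a :: chilbert_space \<Rightarrow> 'b :: chilbert_space"
  assumes Y: "\<And>x y. cmod (cinner (Y x) (Y y)) = cmod (cinner x y)"
  obtains W \<kappa> where "\<kappa> = (\<lambda>c. c) \<or> \<kappa> = cnj" "\<And>x y. cinner (W x) (W y) = \<kappa> (cinner x y)"
    "\<And>x. \<exists>c. cmod c = 1 \<and> Y x = c *\<^sub>C W x"
proof -
  have normY: "norm (Y x) = norm x" for x
  proof -
    have "(norm (Y x))\<^sup>2 = (norm x)\<^sup>2" using Y[of x x] by (simp add: cinner_self norm_power)
    then show ?thesis by (simp add: power2_eq_iff_nonneg)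
  qed
  show thesis
  proof (cases "\<exists>e :: 'a. norm e = 1")
    case False
    have "x = 0" for x :: 'a
    proof (rule ccontr)
      assume "x \<noteq> 0"
      then have "norm (x /\<^sub>R norm x) = 1" by simp
      with False show False by blast
    qed
    then have "cinner x y = 0" for x y :: 'a by (metis cinner_zero_left)
    then show thesis using Y by (intro that[of "\<lambda>c. c" Y]) (auto intro!: exI[of _ 1] simp: scaleC_one)
  next
    case True
    then obtain e :: 'a where e: "norm e = 1" by blast
    define f where "f = Y e"
    have f: "norm f = 1" by (simp add: f_def normY e)
    have ee: "cinner e e = 1" "cinner f f = 1" using e f by (simp_all add: cinner_self)
    define \<gamma> where "\<gamma> = (\<lambda>x. cinner (Y (e + x)) f)"
    define U where "U = (\<lambda>x. inverse (\<gamma> x) *\<^sub>C Y (e + x) - f)"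
    define P where "P = (\<lambda>x. cinner x e = 0)"
    have \<gamma>: "cmod (\<gamma> x) = 1" if "P x" for x
      using Y[of "e + x" e] that by (simp add: \<gamma>_def f_def P_def cinner_algebra ee)
    have YU: "Y (e + x) = \<gamma> x *\<^sub>C (f + U x)" if "P x" for x
    proof -
      have "\<gamma> x \<noteq> 0" using \<gamma>[OF that] by auto
      then show ?thesis by (simp add: U_def scaleC_one)
    qed
    have Uf: "cinner (U x) f = 0" if "P x" for x
    proof -
      have "\<gamma> x \<noteq> 0" using \<gamma>[OF that] by auto
      then show ?thesis by (simp add: U_def cinner_algebra ee \<gamma>_def)
    qed
    have fU: "cinner f (U x) = 0" if "P x" for x
      using Uf[OF that] cinner_commute[of f "U x"] by simp
    have one: "cmod (1 + cinner (U x) (U y)) = cmod (1 + cinner x y)" if x: "P x" and y: "P y" for x y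
    proof -
      have "cinner e y = 0" using y cinner_commute[of e y] by (simp add: P_def)
      then have "cinner (e + x) (e + y) = 1 + cinner x y"
        using x by (simp add: P_def cinner_algebra ee)
      moreover have "cinner (Y (e + x)) (Y (e + y)) = (\<gamma> x * cnj (\<gamma> y)) * (1 + cinner (U x) (U y))"
        unfolding YU[OF x] YU[OF y] using Uf[OF x] fU[OF y]
        by (simp add: cinner_algebra ee distrib_left)
      ultimately show ?thesis using Y[of "e + x" "e + y"] \<gamma>[OF x] \<gamma>[OF y] by (simp add: norm_mult)
    qed
    have Pscale: "P (t *\<^sub>R x)" if "P x" for t x using that by (simp add: P_def cinner_algebra)
    have Padd: "P (x + y)" if "P x" "P y" for x y using that by (simp add: P_def cinner_algebra)
    have Pi: "P (c *\<^sub>C x)" if "P x" for c x using that by (simp add: P_def cinner_algebra)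
    have normU: "norm (U x) = norm x" if x: "P x" for x
    proof -
      have "cmod (of_real (1 + (norm (U x))\<^sup>2)) = cmod (of_real (1 + (norm x)\<^sup>2))"
        using one[OF x x] by (simp add: cinner_self)
      then have "1 + (norm (U x))\<^sup>2 = 1 + (norm x)\<^sup>2"
        unfolding norm_of_real by (simp add: add_nonneg_nonneg)
      then show ?thesis by (simp add: power2_eq_iff_nonneg)
    qed
    have cmod_one: "(cmod (1 + z))\<^sup>2 = 1 + 2 * Re z + (cmod z)\<^sup>2" for z
      unfolding cmod_power2 by (simp add: power2_eq_square algebra_simps)
    \<comment> \<open>\<open>\<bar>1 + w\<bar> = 1 + \<rho>\<close> and \<open>\<bar>w\<bar> \<le> \<rho>\<close> force \<open>w = \<rho>\<close>, the equality case of Cauchy--Schwarz.\<close>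
    have Uscale: "U (t *\<^sub>R x) = t *\<^sub>R U x" if x: "P x" and t: "t > 0" for t x
    proof -
      define w where "w = cinner (U (t *\<^sub>R x)) (U x)"
      define \<rho> where "\<rho> = t * (norm x)\<^sup>2"
      have "\<rho> \<ge> 0" using t by (simp add: \<rho>_def)
      have "cmod (1 + w) = cmod (of_real (1 + \<rho>))"
        using one[OF Pscale[OF x] x, of t] by (simp add: w_def \<rho>_def cinner_algebra cinner_self)
      then have "cmod (1 + w) = 1 + \<rho>" unfolding norm_of_real using \<open>\<rho> \<ge> 0\<close> by simp
      then have "1 + 2 * Re w + (cmod w)\<^sup>2 = 1 + 2 * \<rho> + \<rho>\<^sup>2"
        unfolding cmod_one[symmetric] by (simp add: power2_eq_square algebra_simps)
      moreover have "cmod w \<le> \<rho>"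
        using norm_cinner_le[of "U (t *\<^sub>R x)" "U x"] t
        by (simp add: w_def \<rho>_def normU x Pscale power2_eq_square)
      then have "(cmod w)\<^sup>2 \<le> \<rho>\<^sup>2" by (intro power_mono) auto
      ultimately have "Re w \<ge> \<rho>" by linarith
      then have "U (t *\<^sub>R x) \<bullet> U x \<ge> \<rho>" by (simp add: w_def Re_cinner)
      then have "2 * t * (U (t *\<^sub>R x) \<bullet> U x) \<ge> 2 * t * \<rho>" using t by simp
      moreover have "(norm (U (t *\<^sub>R x) - t *\<^sub>R U x))\<^sup>2
          = (norm (U (t *\<^sub>R x)))\<^sup>2 - 2 * t * (U (t *\<^sub>R x) \<bullet> U x) + t\<^sup>2 * (norm (U x))\<^sup>2"
        unfolding power2_norm_eq_inner
        by (simp add: inner_diff_left inner_diff_right inner_commute algebra_simps power2_eq_square)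
      moreover have "(norm (U (t *\<^sub>R x)))\<^sup>2 = t * \<rho>" "t\<^sup>2 * (norm (U x))\<^sup>2 = t * \<rho>"
        using t by (simp_all add: normU x Pscale \<rho>_def power2_eq_square)
      ultimately have "(norm (U (t *\<^sub>R x) - t *\<^sub>R U x))\<^sup>2 \<le> 0" by linarith
      then show ?thesis by simp
    qed
    \<comment> \<open>Compare coefficients of \<open>t\<close> and \<open>t\<^sup>2\<close> after replacing \<open>x\<close> by \<open>t x\<close>.\<close>
    have ReU: "U x \<bullet> U y = x \<bullet> y" and modU: "cmod (cinner (U x) (U y)) = cmod (cinner x y)"
      if x: "P x" and y: "P y" for x y
    proof -
      define w where "w = cinner (U x) (U y)"
      define z where "z = cinner x y"
      have sq: "(cmod (1 + of_real t * w))\<^sup>2 = (cmod (1 + of_real t * z))\<^sup>2" if "t > 0" for t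
        using one[OF Pscale[OF x] y, of t] by (simp add: Uscale[OF x that] w_def z_def cinner_algebra)
      have "1 + 2 * Re w + (cmod w)\<^sup>2 = 1 + 2 * Re z + (cmod z)\<^sup>2"
        using sq[of 1] by (simp add: cmod_one)
      moreover have "1 + 4 * Re w + 4 * (cmod w)\<^sup>2 = 1 + 4 * Re z + 4 * (cmod z)\<^sup>2"
        using sq[of 2] unfolding cmod_one by (simp add: norm_mult power_mult_distrib)
      ultimately have "Re w = Re z" "(cmod w)\<^sup>2 = (cmod z)\<^sup>2" by linarith+
      then show "U x \<bullet> U y = x \<bullet> y" "cmod (cinner (U x) (U y)) = cmod (cinner x y)"
        by (simp_all add: w_def z_def Re_cinner power2_eq_iff_nonneg)
    qed
    have Uadd: "U (x + y) = U x + U y" if x: "P x" and y: "P y" for x y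
    proof -
      have "(norm (U (x + y) - (U x + U y)))\<^sup>2 = 0"
        unfolding power2_norm_eq_inner using x y Padd[OF x y]
        by (simp add: inner_diff_left inner_diff_right inner_add_left inner_add_right ReU)
      then show ?thesis by simp
    qed
    have Ui: "U (\<i> *\<^sub>C x) = \<i> *\<^sub>C U x \<or> U (\<i> *\<^sub>C x) = (- \<i>) *\<^sub>C U x" if x: "P x" for x
    proof (cases "x = 0")
      case True
      then have "norm (U x) = 0" using normU[OF x] by simp
      then show ?thesis using True by simp
    next
      case False
      have nx: "norm (U (\<i> *\<^sub>C x)) = norm (U x)" by (simp add: normU x Pi norm_scaleC)
      have "cmod (cinner (U (\<i> *\<^sub>C x)) (U x)) = norm (U (\<i> *\<^sub>C x)) * norm (U x)"
        unfolding modU[OF Pi[OF x] x]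
        by (simp add: normU x Pi norm_scaleC cinner_algebra cinner_self norm_mult norm_power power2_eq_square)
      from parallel_if_norm_cinner_eq[OF this nx]
      obtain c where c: "cmod c = 1" "U (\<i> *\<^sub>C x) = c *\<^sub>C U x" by blast
      have "U (\<i> *\<^sub>C x) \<bullet> U x = 0"
        unfolding ReU[OF Pi[OF x] x] by (simp add: Re_cinner[symmetric] cinner_algebra cinner_self)
      then have "Re c * (norm (U x))\<^sup>2 = 0"
        unfolding c(2) by (simp add: Re_cinner[symmetric] cinner_algebra cinner_self)
      then have "Re c = 0" using False normU[OF x] by simp
      then have "\<bar>Im c\<bar> = 1" using c(1) by (simp add: cmod_def)
      then have "c = \<i> \<or> c = - \<i>" using \<open>Re c = 0\<close> by (auto simp: complex_eq_iff abs_if split: if_splits)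
      then show ?thesis using c(2) by auto
    qed
    have "\<exists>\<epsilon>\<in>{\<i>, - \<i>}. \<forall>x. P x \<longrightarrow> U (\<i> *\<^sub>C x) = \<epsilon> *\<^sub>C U x"
    proof (rule ccontr)
      assume "\<not> ?thesis"
      then obtain x y where x: "P x" "U (\<i> *\<^sub>C x) \<noteq> \<i> *\<^sub>C U x"
        and y: "P y" "U (\<i> *\<^sub>C y) \<noteq> (- \<i>) *\<^sub>C U y" by auto
      have xy: "U (\<i> *\<^sub>C x) = (- \<i>) *\<^sub>C U x" "U (\<i> *\<^sub>C y) = \<i> *\<^sub>C U y" using Ui x y by blast+
      have "U (\<i> *\<^sub>C (x + y)) = (- \<i>) *\<^sub>C U x + \<i> *\<^sub>C U y"
        using Uadd[OF Pi[OF x(1)] Pi[OF y(1)], of \<i> \<i>] by (simp add: scaleC_add_right xy)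
      moreover have "U (\<i> *\<^sub>C (x + y)) = \<i> *\<^sub>C U x + \<i> *\<^sub>C U y
          \<or> U (\<i> *\<^sub>C (x + y)) = (- \<i>) *\<^sub>C U x + (- \<i>) *\<^sub>C U y"
        using Ui[OF Padd[OF x(1) y(1)]] Uadd[OF x(1) y(1)] by (simp only: scaleC_add_right)
      ultimately show False using x(2) y(2) xy by auto
    qed
    then obtain \<epsilon> where \<epsilon>: "\<epsilon> \<in> {\<i>, - \<i>}" and U\<epsilon>: "\<And>x. P x \<Longrightarrow> U (\<i> *\<^sub>C x) = \<epsilon> *\<^sub>C U x" by blast
    define \<kappa> :: "complex \<Rightarrow> complex" where "\<kappa> = (if \<epsilon> = \<i> then (\<lambda>c. c) else cnj)"
    have \<kappa>: "\<kappa> = (\<lambda>c. c) \<or> \<kappa> = cnj" by (simp add: \<kappa>_def)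
    have \<kappa>_simps: "\<kappa> (a + b) = \<kappa> a + \<kappa> b" "\<kappa> (a * b) = \<kappa> a * \<kappa> b" "\<kappa> 0 = 0" "\<kappa> 1 = 1"
      "cmod (\<kappa> a) = cmod a" "\<kappa> (cnj a) = cnj (\<kappa> a)" for a b
      using \<kappa> by auto
    have Ucinner: "cinner (U x) (U y) = \<kappa> (cinner x y)" if x: "P x" and y: "P y" for x y
    proof -
      have "Re (cinner (U x) (U y)) = Re (cinner x y)" by (simp add: Re_cinner ReU x y)
      moreover have "Re (cinner (U x) (U (\<i> *\<^sub>C y))) = Re (cinner x (\<i> *\<^sub>C y))"
        by (simp add: Re_cinner ReU x y Pi)
      then have "Re (cnj \<epsilon> * cinner (U x) (U y)) = Im (cinner x y)"
        by (simp add: U\<epsilon> y cinner_algebra)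
      then have "Im (cinner (U x) (U y)) = (if \<epsilon> = \<i> then 1 else -1) * Im (cinner x y)"
        using \<epsilon> by (auto simp: complex_eq_iff)
      ultimately show ?thesis by (simp add: \<kappa>_def complex_eq_iff)
    qed
    define W where "W = (\<lambda>h. \<kappa> (cinner h e) *\<^sub>C f + U (h - cinner h e *\<^sub>C e))"
    have Ph: "P (h - cinner h e *\<^sub>C e)" for h by (simp add: P_def cinner_algebra ee)
    have W: "cinner (W h) (W h') = \<kappa> (cinner h h')" for h h'
    proof -
      define a x where "a = cinner h e" and "x = h - cinner h e *\<^sub>C e"
      define a' x' where "a' = cinner h' e" and "x' = h' - cinner h' e *\<^sub>C e"
      have P: "P x" "P x'" by (simp_all add: x_def x'_def Ph)
      have "cinner e x' = 0" using P(2) cinner_commute[of e x'] by (simp add: P_def)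
      moreover have "h = a *\<^sub>C e + x" "h' = a' *\<^sub>C e + x'" by (simp_all add: a_def x_def a'_def x'_def)
      ultimately have "cinner h h' = a * cnj a' + cinner x x'"
        using P(1) by (simp add: cinner_algebra ee P_def)
      then have "\<kappa> (cinner h h') = \<kappa> a * cnj (\<kappa> a') + cinner (U x) (U x')"
        by (simp add: \<kappa>_simps Ucinner P)
      also have "\<dots> = cinner (\<kappa> a *\<^sub>C f + U x) (\<kappa> a' *\<^sub>C f + U x')"
        using Uf[OF P(1)] fU[OF P(2)] by (simp add: cinner_algebra ee)
      finally show ?thesis by (simp add: W_def a_def x_def a'_def x'_def)
    qed
    note W_props = semi_isometry[OF \<kappa> W]
    have Uzero: "U 0 = 0" using normU[of 0] by (simp add: P_def)
    have We: "W (e + x) = f + U x" if "P x" for x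
      using that by (simp add: W_def P_def cinner_algebra ee \<kappa>_simps scaleC_one)
    have WU: "W x = U x" if "P x" for x using that by (simp add: W_def P_def \<kappa>_simps)
    have "\<exists>c. cmod c = 1 \<and> Y h = c *\<^sub>C W h" for h
    proof -
      have key: "cmod (cinner (Y h) (W h)) = norm h * norm h"
      proof (cases "cinner h e = 0")
        case True
        then have P: "P h" by (simp add: P_def)
        have "cinner h (e + h) = (norm h)\<^sup>2" using P by (simp add: P_def cinner_algebra cinner_self)
        then have "cmod (cinner (Y h) (\<gamma> h *\<^sub>C (f + U h))) = (norm h)\<^sup>2"
          using Y[of h "e + h"] by (simp add: YU[OF P] norm_power)
        moreover have "cmod (cinner (Y h) f) = 0" using Y[of h e] True by (simp add: f_def)
        ultimately show ?thesis
          using \<gamma>[OF P] by (simp add: WU[OF P] cinner_algebra norm_mult power2_eq_square)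
      next
        case False
        define a where "a = cinner h e"
        define x where "x = inverse a *\<^sub>C (h - cinner h e *\<^sub>C e)"
        have a: "a \<noteq> 0" using False by (simp add: a_def)
        have P: "P x" by (simp add: x_def Pi Ph)
        have h: "h = a *\<^sub>C (e + x)"
          using a by (simp add: x_def a_def scaleC_add_right scaleC_one)
        have "cmod (cinner (Y h) (\<gamma> x *\<^sub>C (f + U x))) = cmod a * (norm (e + x))\<^sup>2"
          using Y[of h "e + x"] unfolding YU[OF P]
          by (simp add: h cinner_scaleC_left cinner_self norm_mult norm_power)
        then have "cmod (cinner (Y h) (W (e + x))) = cmod a * (norm (e + x))\<^sup>2"
          using \<gamma>[OF P] by (simp add: We[OF P] cinner_scaleC_right norm_mult)
        moreover have "W h = \<kappa> a *\<^sub>C W (e + x)" unfolding h by (rule W_props(4))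
        moreover have "norm h = cmod a * norm (e + x)" unfolding h by (rule norm_scaleC)
        ultimately show ?thesis
          by (simp add: cinner_scaleC_right norm_mult \<kappa>_simps power2_eq_square)
      qed
      have "cmod (cinner (Y h) (W h)) = norm (Y h) * norm (W h)" "norm (Y h) = norm (W h)"
        using key by (simp_all add: normY W_props(2))
      then show ?thesis using parallel_if_norm_cinner_eq[of "Y h" "W h"] by metis
    qed
    then show thesis using that[of \<kappa> W] \<kappa> W by blast
  qed
qed

section \<open>Conjugation with respect to an orthonormal basis\<close>

lemma bounded_linear_cinner_left: "bounded_linear (\<lambda>x. cinner x y)" for y :: "'a :: chilbert_space"
  by (rule bounded_linear_intro[where K = "norm y"])
    (simp_all add: cinner_algebra scaleR_conv_of_real norm_cinner_le)

lemma bounded_linear_cinner_right: "bounded_linear (\<lambda>y. cinner x y)" for x :: "'a :: chilbert_space"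
  by (rule bounded_linear_intro[where K = "norm x"])
    (simp_all add: cinner_algebra scaleR_conv_of_real norm_cinner_le mult.commute[of _ "norm x"])

lemma dense_span_induct:
  fixes E :: "'a :: chilbert_space set"
  assumes "closure (cvec.span E) = UNIV" and "closed {x. Q x}" and "\<And>x. x \<in> cvec.span E \<Longrightarrow> Q x"
  shows "Q x"
  using closure_minimal[of "cvec.span E" "{x. Q x}"] assms by auto

lemma orthonormal_basis_eqI:
  fixes E :: "'a :: chilbert_space set"
  assumes E: "orthonormal_basis E" and eq: "\<And>e. e \<in> E \<Longrightarrow> cinner x e = cinner y e"
  shows "x = y"
proof -
  have "cinner (x - y) z = 0" for z
  proof (rule dense_span_induct[of E])
    show "closure (cvec.span E) = UNIV" using E by (simp add: orthonormal_basis_def)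
    show "closed {z. cinner (x - y) z = 0}"
      by (intro closed_Collect_eq continuous_intros linear_continuous_on bounded_linear_cinner_right)
    show "cinner (x - y) z = 0" if "z \<in> cvec.span E" for z
      using that by (induction rule: cvec.span_induct_alt) (simp_all add: cinner_algebra eq)
  qed
  from this[of "x - y"] show ?thesis by (simp add: cinner_self)
qed

text \<open>Conjugating the coefficients is possible on the span of the basis and isometric there, hence
  extends to the closure. That the inner product is conjugated is shown by induction on the span,
  against any pair of vectors with conjugate coefficients, so that no expansion into sums is needed.\<close>

lemma conjugation_exists:
  fixes E :: "'a :: chilbert_space set"
  assumes E: "orthonormal_basis E"
  obtains J where "\<And>x y. cinner (J x) (J y) = cnj (cinner x y)" "\<And>x. J (J x) = x"
    "\<And>e. e \<in> E \<Longrightarrow> J e = e"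
proof -
  have dense: "closure (cvec.span E) = UNIV" using E by (simp add: orthonormal_basis_def)
  define R where "R = (\<lambda>x y. \<forall>e\<in>E. cinner y e = cnj (cinner x e))"
  have ex: "\<exists>y. R x y \<and> (\<forall>x' y'. R x' y' \<longrightarrow> cinner y y' = cnj (cinner x x'))"
    if "x \<in> cvec.span E" for x
    using that
  proof (induction rule: cvec.span_induct_alt)
    case base
    show ?case by (rule exI[of _ 0]) (simp add: R_def)
  next
    case (step c e x)
    then obtain y where y: "R x y" "\<And>x' y'. R x' y' \<Longrightarrow> cinner y y' = cnj (cinner x x')" by blast
    have e: "cinner e y' = cnj (cinner e x')" if "R x' y'" for x' y'
      using that step(1) cinner_commute[of e] by (simp add: R_def)
    have "cnj (cinner e f) = cinner e f" if "f \<in> E" for f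
      using E that step(1) by (auto simp: orthonormal_basis_def)
    then have "R (c *\<^sub>C e + x) (cnj c *\<^sub>C e + y)" using y(1) by (simp add: R_def cinner_algebra)
    moreover have "cinner (cnj c *\<^sub>C e + y) y' = cnj (cinner (c *\<^sub>C e + x) x')" if "R x' y'" for x' y'
      using y(2)[OF that] e[OF that] by (simp add: cinner_algebra)
    ultimately show ?case by blast
  qed
  then obtain J0 where R0: "\<And>x. x \<in> cvec.span E \<Longrightarrow> R x (J0 x)"
    and J0': "\<And>x x' y'. x \<in> cvec.span E \<Longrightarrow> R x' y' \<Longrightarrow> cinner (J0 x) y' = cnj (cinner x x')"
    by metis
  have J0: "cinner (J0 x) (J0 y) = cnj (cinner x y)" if "x \<in> cvec.span E" "y \<in> cvec.span E" for x y
    using J0' R0 that by blast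
  have "dist (J0 x) (J0 y) = dist x y" if x: "x \<in> cvec.span E" and y: "y \<in> cvec.span E" for x y
  proof -
    have "J0 u \<bullet> J0 v = u \<bullet> v" if "u \<in> cvec.span E" "v \<in> cvec.span E" for u v
      using J0[OF that] by (simp flip: Re_cinner)
    then show ?thesis
      using x y by (simp add: dist_norm norm_eq_sqrt_inner inner_diff_left inner_diff_right)
  qed
  then have "uniformly_continuous_on (cvec.span E) J0"
    unfolding uniformly_continuous_on_def by metis
  from uniformly_continuous_on_extension_on_closure[OF this]
  obtain J where "uniformly_continuous_on (closure (cvec.span E)) J"
    and JJ0: "\<And>x. x \<in> cvec.span E \<Longrightarrow> J0 x = J x" by metis
  then have contJ: "continuous_on UNIV J"
    using dense by (simp add: uniformly_continuous_imp_continuous)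
  note cont_left = continuous_on_compose2[OF linear_continuous_on[OF bounded_linear_cinner_left] contJ]
  note cont_right = continuous_on_compose2[OF linear_continuous_on[OF bounded_linear_cinner_right] contJ]
  have J1: "cinner (J x) (J y) = cnj (cinner x y)" if y: "y \<in> cvec.span E" for x y
  proof (rule dense_span_induct[OF dense, where Q = "\<lambda>x. cinner (J x) (J y) = cnj (cinner x y)"])
    show "closed {x. cinner (J x) (J y) = cnj (cinner x y)}"
      by (intro closed_Collect_eq continuous_on_cnj cont_left linear_continuous_on
          bounded_linear_cinner_left) auto
  qed (use y J0 JJ0 in simp)
  have J: "cinner (J x) (J y) = cnj (cinner x y)" for x y
  proof (rule dense_span_induct[OF dense, where Q = "\<lambda>y. cinner (J x) (J y) = cnj (cinner x y)"])
    show "closed {y. cinner (J x) (J y) = cnj (cinner x y)}"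
      by (intro closed_Collect_eq continuous_on_cnj cont_right linear_continuous_on
          bounded_linear_cinner_right) auto
  qed (use J1 in simp)
  have Je: "J e = e" if e: "e \<in> E" for e
  proof (rule orthonormal_basis_eqI[OF E])
    fix f assume f: "f \<in> E"
    have "cinner (J e) f = cnj (cinner e f)"
      using R0[OF cvec.span_base[OF e]] JJ0[OF cvec.span_base[OF e]] f by (simp add: R_def)
    also have "\<dots> = cinner e f" using E e f by (auto simp: orthonormal_basis_def)
    finally show "cinner (J e) f = cinner e f" .
  qed
  have "J (J x) = x" for x
  proof (rule orthonormal_basis_eqI[OF E])
    fix e assume "e \<in> E"
    then show "cinner (J (J x)) e = cinner x e"
      using J[of "J x" "J e"] J[of x e] Je by simp
  qed
  then show thesis using that[of J] J Je by blast
qed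

lemma bounded_clinear_eqI_on_basis:
  fixes S T :: "'a :: chilbert_space \<Rightarrow> 'b :: chilbert_space"
  assumes E: "orthonormal_basis E" and S: "bounded_clinear S" and T: "bounded_clinear T"
    and eq: "\<And>e. e \<in> E \<Longrightarrow> S e = T e"
  shows "S = T"
proof
  fix x
  interpret S: bounded_linear S by (rule bounded_clinear_linear[OF S])
  interpret T: bounded_linear T by (rule bounded_clinear_linear[OF T])
  show "S x = T x"
  proof (rule dense_span_induct[of E])
    show "closure (cvec.span E) = UNIV" using E by (simp add: orthonormal_basis_def)
    show "closed {x. S x = T x}"
      by (intro closed_Collect_eq linear_continuous_on S.bounded_linear_axioms T.bounded_linear_axioms)
    show "S x = T x" if "x \<in> cvec.span E" for x
      using that
      by (induction rule: cvec.span_induct_alt)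
        (simp_all add: S.zero T.zero S.add T.add eq bounded_clinear_scaleC[OF S] bounded_clinear_scaleC[OF T])
  qed
qed

context
  fixes J :: "'a :: chilbert_space \<Rightarrow> 'a"
  assumes J: "\<And>x y. cinner (J x) (J y) = cnj (cinner x y)" and JJ: "\<And>x. J (J x) = x"
begin

lemma cinner_conjugation: "cinner (J x) y = cnj (cinner x (J y))"
  using J[of x "J y"] by (simp add: JJ)

lemma selfadjoint_conjugate:
  assumes A: "A \<in> selfadjoint_ops"
  shows "(\<lambda>x. J (A (J x))) \<in> selfadjoint_ops"
  unfolding selfadjoint_ops_iff
proof (intro conjI allI)
  interpret A: bounded_linear A by (rule selfadjoint_linear[OF A])
  obtain K where K: "\<And>x. norm (A x) \<le> norm x * K" using A.bounded by blast
  note J_props = semi_isometry[of cnj J, OF disjI2[OF refl] J]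
  show "bounded_clinear (\<lambda>x. J (A (J x)))"
    by (rule bounded_clinear_intro[where K = K])
      (use K[of "J _"] in \<open>simp_all add: J_props A.add bounded_clinear_scaleC[OF selfadjoint_clinear[OF A]]\<close>)
  show "cinner (J (A (J x))) y = cinner x (J (A (J y)))" for x y
    using cinner_conjugation[of "A (J x)" y] cinner_conjugation[of x "A (J y)"] J[of x "J (A (J y))"]
    by (simp add: JJ selfadjoint_cinner[OF A])
qed

lemma conjugate_form: "J (A (J x)) \<bullet> x = A (J x) \<bullet> J x"
  using cinner_conjugation[of "A (J x)" x] by (simp flip: Re_cinner)

lemma op_transpose_eq_conjugate:
  assumes E: "orthonormal_basis E" and Je: "\<And>e. e \<in> E \<Longrightarrow> J e = e" and A: "A \<in> selfadjoint_ops"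
  shows "op_transpose E A = (\<lambda>x. J (A (J x)))"
  unfolding op_transpose_def
proof (rule the_equality)
  have entries: "mat_entry (\<lambda>x. J (A (J x))) f e = mat_entry A e f" if "e \<in> E" "f \<in> E" for e f
    using that cinner_conjugation[of "A e" f] cinner_commute[of "A f" e]
    by (simp add: mat_entry_def Je selfadjoint_cinner[OF A, of f e, symmetric] selfadjoint_cinner[OF A, of e f])
  show T: "bounded_clinear (\<lambda>x. J (A (J x)))
      \<and> (\<forall>e\<in>E. \<forall>f\<in>E. mat_entry (\<lambda>x. J (A (J x))) f e = mat_entry A e f)"
    using selfadjoint_clinear[OF selfadjoint_conjugate[OF A]] entries by blast
  fix T assume "bounded_clinear T \<and> (\<forall>e\<in>E. \<forall>f\<in>E. mat_entry T f e = mat_entry A e f)"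
  with T show "T = (\<lambda>x. J (A (J x)))"
    by (intro bounded_clinear_eqI_on_basis[OF E] orthonormal_basis_eqI[OF E])
      (auto simp: mat_entry_def)
qed

end

section \<open>The form of spectrum preservers\<close>

lemma selfadjoint_form_scaleC:
  assumes A: "A \<in> selfadjoint_ops"
  shows "A (c *\<^sub>C x) \<bullet> (c *\<^sub>C x) = (cmod c)\<^sup>2 * (A x \<bullet> x)"
proof -
  have "cinner (A (c *\<^sub>C x)) (c *\<^sub>C x) = c * cnj c * cinner (A x) x"
    by (simp add: bounded_clinear_scaleC[OF selfadjoint_clinear[OF A]] cinner_algebra)
  also have "\<dots> = of_real ((cmod c)\<^sup>2 * (A x \<bullet> x))"
    unfolding of_real_mult complex_norm_square by (simp add: selfadjoint_form_real[OF A])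
  finally show ?thesis by (metis Re_cinner Re_complex_of_real)
qed

lemma selfadjoint_polarization:
  assumes A: "A \<in> selfadjoint_ops"
  shows "4 * (A x \<bullet> y) = A (x + y) \<bullet> (x + y) - A (x - y) \<bullet> (x - y)"
proof -
  interpret A: bounded_linear A by (rule selfadjoint_linear[OF A])
  show ?thesis using selfadjoint_inner[OF A, of y x]
    by (simp add: A.add A.diff inner_add_left inner_add_right inner_diff_left inner_diff_right
        inner_commute[of y])
qed

context spectrum_preserver
begin

lemma image_zero_form:
  assumes y: "norm y = 1"
  shows "\<Phi> (\<lambda>x. 0) y \<bullet> y = 0"
proof -
  have Z: "\<Phi> (\<lambda>x. 0) \<in> selfadjoint_ops" by (rule maps_selfadjoint[OF selfadjoint_zero])
  obtain B where B: "B \<in> selfadjoint_ops" "\<Phi> B = (\<lambda>h. 1 *\<^sub>R rank_one y h)"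
    using range_rank_one[of 1 y] by (metis imageE)
  obtain v where v: "v \<bullet> y = \<Phi> (\<lambda>x. 0) y \<bullet> y" "Im (cinner v y) = 0"
    and sv: "sandwich r s (\<Phi> (\<lambda>x. 0)) (\<lambda>h. 1 *\<^sub>R rank_one y h) = sym_tensor (1 ^ (r + s) *\<^sub>R v) y"
    using sandwich_rank_one_right[OF Z y r] by metis
  have "(B ^^ j) 0 = 0" for j
    using selfadjoint_linear[OF selfadjoint_funpow[OF B(1)], of j]
    by (simp add: linear_0 bounded_linear.linear)
  then have "sandwich r s (\<lambda>x. 0) B = sym_tensor (0::'a) 0"
    by (simp add: sandwich_def sym_tensor_def fun_eq_iff)
  then have "spectrum (sym_tensor v y) = spectrum (sym_tensor (0::'a) 0)"
    using spectrum_eq[OF selfadjoint_zero B(1) disjI1[OF op_rank_zero]] sv by (simp add: B(2))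
  from inner_determined_by_spectrum[OF v(2) _ this] v(1) show ?thesis by simp
qed

text \<open>The images of rank-one projections are rank-one projections up to a sign. The transition
  probability \<open>\<bar>\<langle>x, z\<rangle>\<bar>\<^sup>2\<close> determines the product of the signs at \<open>x\<close> and \<open>z\<close>; as any two
  unit vectors have a third one that is orthogonal to neither, the sign is constant.\<close>

lemma form_preserving_map:
  assumes "\<exists>x :: 'a. norm x = 1"
  obtains \<xi> :: real and Y where "\<xi> \<in> {-1, 1}" "\<xi> ^ (r + s + 1) = 1"
    "\<And>x y. cmod (cinner (Y x) (Y y)) = cmod (cinner x y)"
    "\<And>A x. A \<in> selfadjoint_ops \<Longrightarrow> A x \<bullet> x = \<xi> * (\<Phi> A (Y x) \<bullet> Y x)"
proof -
  have "\<forall>x. \<exists>c y. norm x = 1 \<longrightarrow> norm y = 1 \<and> c \<in> {-1, 1} \<and> c ^ (r + s + 1) = 1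
      \<and> \<Phi> (rank_one x) = (\<lambda>h. c *\<^sub>R rank_one y h)"
    using image_rank_one by metis
  then obtain c y where y: "\<And>x. norm x = 1 \<Longrightarrow> norm (y x) = 1"
    and c: "\<And>x. norm x = 1 \<Longrightarrow> c x \<in> {-1, 1}" "\<And>x. norm x = 1 \<Longrightarrow> c x ^ (r + s + 1) = 1"
    and \<Phi>x: "\<And>x. norm x = 1 \<Longrightarrow> \<Phi> (rank_one x) = (\<lambda>h. c x *\<^sub>R rank_one (y x) h)"
    by metis
  have cn: "c x ^ (r + s) = c x" if "norm x = 1" for x
    using c(2)[OF that] c(1)[OF that] by auto
  have form: "A x \<bullet> x = c x * (\<Phi> A (y x) \<bullet> y x)" if "A \<in> selfadjoint_ops" "norm x = 1" for A x
    using form_eq_if_image_rank_one[OF that(1) \<Phi>x[OF that(2)] that(2) y[OF that(2)]]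
    by (simp only: cn[OF that(2)])
  have trans: "(cmod (cinner x z))\<^sup>2 = c x * c z * (cmod (cinner (y x) (y z)))\<^sup>2"
    if "norm x = 1" "norm z = 1" for x z
    using form[OF selfadjoint_rank_one that(1), of z] by (simp add: rank_one_form \<Phi>x[OF that(2)])
  have c_eq': "c x = c z" if "norm x = 1" "norm z = 1" "cinner x z \<noteq> 0" for x z
  proof -
    have "c x * c z * (cmod (cinner (y x) (y z)))\<^sup>2 > 0"
      using that(3) by (simp flip: trans[OF that(1,2)])
    then have "c x * c z > 0" by (simp add: zero_less_mult_iff)
    then show ?thesis using c(1)[OF that(1)] c(1)[OF that(2)] by auto
  qed
  have c_eq: "c x = c z" if x: "norm x = 1" and z: "norm z = 1" for x z
  proof (cases "cinner x z = 0")
    case True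
    define w where "w = (x + z) /\<^sub>R norm (x + z)"
    have 1: "cinner x (x + z) = 1" "cinner z (x + z) = 1"
      using x z True cinner_commute[of z x] by (simp_all add: cinner_algebra cinner_self)
    then have "x + z \<noteq> 0" by auto
    then have "norm w = 1" "cinner x w \<noteq> 0" "cinner z w \<noteq> 0"
      using 1 by (simp_all add: w_def cinner_scaleR_right)
    then show ?thesis using c_eq' x z by metis
  qed (use c_eq' x z in blast)
  obtain x0 :: 'a where x0: "norm x0 = 1" using assms by blast
  define \<xi> where "\<xi> = c x0"
  have c\<xi>: "c x = \<xi>" if "norm x = 1" for x using c_eq[OF that x0] by (simp add: \<xi>_def)
  have \<xi>: "\<xi> \<in> {-1, 1}" "\<xi> ^ (r + s + 1) = 1" unfolding \<xi>_def by (rule c[OF x0])+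
  define Y where "Y = (\<lambda>x. norm x *\<^sub>R y (x /\<^sub>R norm x))"
  have "cmod (cinner (Y x) (Y z)) = cmod (cinner x z)" for x z
  proof (cases "x = 0 \<or> z = 0")
    case False
    define x1 z1 where "x1 = x /\<^sub>R norm x" and "z1 = z /\<^sub>R norm z"
    have n: "norm x1 = 1" "norm z1 = 1" using False by (simp_all add: x1_def z1_def)
    have "(cmod (cinner x1 z1))\<^sup>2 = (cmod (cinner (y x1) (y z1)))\<^sup>2"
      using trans[OF n] \<xi>(1) by (auto simp: c\<xi> n)
    then have "cmod (cinner x1 z1) = cmod (cinner (y x1) (y z1))" by (simp add: power2_eq_iff_nonneg)
    moreover have "x = norm x *\<^sub>R x1" "z = norm z *\<^sub>R z1" using False by (simp_all add: x1_def z1_def)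
    then have "cinner x z = norm x * (norm z * cinner x1 z1)" by (metis cinner_scaleR_left cinner_scaleR_right)
    ultimately show ?thesis
      by (simp add: Y_def x1_def[symmetric] z1_def[symmetric] cinner_scaleR_left cinner_scaleR_right norm_mult)
  qed (auto simp: Y_def)
  moreover have "A x \<bullet> x = \<xi> * (\<Phi> A (Y x) \<bullet> Y x)" if A: "A \<in> selfadjoint_ops" for A x
  proof (cases "x = 0")
    case False
    define x1 where "x1 = x /\<^sub>R norm x"
    have n: "norm x1 = 1" using False by (simp add: x1_def)
    have x: "x = of_real (norm x) *\<^sub>C x1" using False by (simp add: x1_def scaleC_of_real)
    have "A x \<bullet> x = (norm x)\<^sup>2 * (A x1 \<bullet> x1)"
      using selfadjoint_form_scaleC[OF A, of "of_real (norm x)" x1] x by simp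
    also have "\<dots> = \<xi> * ((norm x)\<^sup>2 * (\<Phi> A (y x1) \<bullet> y x1))"
      using form[OF A n] c\<xi>[OF n] by simp
    also have "(norm x)\<^sup>2 * (\<Phi> A (y x1) \<bullet> y x1) = \<Phi> A (Y x) \<bullet> Y x"
      using selfadjoint_form_scaleC[OF maps_selfadjoint[OF A], of "of_real (norm x)" "y x1"]
      by (simp add: Y_def x1_def scaleC_of_real)
    finally show ?thesis .
  qed (simp add: Y_def)
  ultimately show thesis using that[of \<xi> Y] \<xi> by blast
qed

text \<open>Surjectivity of \<open>V\<close>: an operator \<open>A\<close> with \<open>\<Phi> A = z \<otimes> z\<close> has the form
  \<open>\<langle>\<Theta> A h, h\<rangle> = \<xi> \<bar>\<langle>V h, z\<rangle>\<bar>\<^sup>2\<close>, which represents the functional \<open>h \<mapsto> z \<bullet> V h\<close> by a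
  vector \<open>a\<close>. Then \<open>w = z - V a\<close> is orthogonal to the range of \<open>V\<close>; so an operator mapped to
  \<open>w \<otimes> w\<close> must be zero. As the form of \<open>\<Phi> 0\<close> vanishes, \<open>w = 0\<close>.\<close>

lemma unitary_if_form:
  fixes V :: "'a \<Rightarrow> 'b" and \<Theta> :: "('a \<Rightarrow> 'a) \<Rightarrow> 'a \<Rightarrow> 'a"
  assumes \<xi>: "\<xi> \<in> {-1, 1 :: real}" and V: "\<And>x y. cinner (V x) (V y) = cinner x y"
    and \<Theta>: "\<And>A. A \<in> selfadjoint_ops \<Longrightarrow> \<Theta> A \<in> selfadjoint_ops"
    and \<Theta>_zero: "\<And>A. A \<in> selfadjoint_ops \<Longrightarrow> \<Theta> A = (\<lambda>x. 0) \<Longrightarrow> A = (\<lambda>x. 0)"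
    and form: "\<And>A x. A \<in> selfadjoint_ops \<Longrightarrow> \<Theta> A x \<bullet> x = \<xi> * (\<Phi> A (V x) \<bullet> V x)"
  shows "unitary V"
    and "A \<in> selfadjoint_ops \<Longrightarrow> \<Phi> A = (\<lambda>x. \<xi> *\<^sub>R V (\<Theta> A (cadjoint V x)))"
proof -
  note V_props = semi_isometry[of "\<lambda>c. c" V, OF disjI1[OF refl] V]
  have \<xi>\<xi>: "\<xi> * (\<xi> * t) = t" for t using \<xi> by auto
  have Vbl: "bounded_clinear V"
    by (rule bounded_clinear_intro[where K = 1]) (simp_all add: V_props)
  interpret V: bounded_linear V by (rule bounded_clinear_linear[OF Vbl])
  have perp: "w = 0" if w: "\<And>h. w \<bullet> V h = 0" for w
  proof (rule ccontr)
    assume "w \<noteq> 0"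
    define w1 where "w1 = w /\<^sub>R norm w"
    have n: "norm w1 = 1" using \<open>w \<noteq> 0\<close> by (simp add: w1_def)
    have "cinner (V h) w1 = 0" for h
    proof -
      have "Re (cinner w (V h)) = 0" "Im (cinner w (V h)) = 0"
        using w[of h] w[of "\<i> *\<^sub>C h"] by (simp_all add: Re_cinner V_props(4) inner_scaleC_i)
      then have "cinner w (V h) = 0" by (simp add: complex_eq_iff)
      then show ?thesis using cinner_commute[of "V h" w] by (simp add: w1_def cinner_scaleR_right)
    qed
    moreover obtain A where A: "A \<in> selfadjoint_ops" "\<Phi> A = (\<lambda>h. 1 *\<^sub>R rank_one w1 h)"
      using range_rank_one[of 1 w1] by (metis imageE)
    ultimately have "\<Theta> A h \<bullet> h = 0" for h by (simp add: form rank_one_form)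
    then have "\<Theta> A = (\<lambda>x. 0)" by (intro selfadjoint_eqI[OF \<Theta>[OF A(1)] selfadjoint_zero]) simp
    then have "A = (\<lambda>x. 0)" by (rule \<Theta>_zero[OF A(1)])
    then have "rank_one w1 w1 \<bullet> w1 = 0" using image_zero_form[OF n] A(2) by simp
    then show False using n by (simp add: rank_one_form cinner_self)
  qed
  have "\<exists>a. z = V a" for z
  proof -
    obtain A where A: "A \<in> selfadjoint_ops" "\<Phi> A = (\<lambda>h. 1 *\<^sub>R rank_one z h)"
      using range_rank_one[of 1 z] by (metis imageE)
    have q: "\<Theta> A h \<bullet> h = \<xi> * (cmod (cinner (V h) z))\<^sup>2" for h
      by (simp add: form[OF A(1)] A(2) rank_one_form)
    obtain a where a: "\<And>h. a \<bullet> h = z \<bullet> V h"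
    proof (cases "\<exists>h. cinner (V h) z \<noteq> 0")
      case False
      then have "z \<bullet> V h = 0" for h by (metis Re_cinner inner_commute zero_complex.sel(1))
      then show ?thesis using that[of 0] by simp
    next
      case True
      then obtain h where h: "cinner (V h) z \<noteq> 0" by blast
      define h0 where "h0 = inverse (cinner (V h) z) *\<^sub>C h"
      have h0: "cinner (V h0) z = 1" using h by (simp add: h0_def V_props(4) cinner_scaleC_left)
      have polar: "(cmod (1 + t))\<^sup>2 - (cmod (1 - t))\<^sup>2 = 4 * Re t" for t
        unfolding cmod_power2 by (simp add: power2_eq_square algebra_simps)
      have "(\<xi> *\<^sub>R \<Theta> A h0) \<bullet> h = z \<bullet> V h" for h
      proof -
        have "4 * (\<Theta> A h0 \<bullet> h) = \<xi> * (4 * Re (cinner (V h) z))"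
          unfolding selfadjoint_polarization[OF \<Theta>[OF A(1)]] q polar[symmetric]
          by (simp add: V.add V.diff cinner_add_left cinner_diff_left h0 right_diff_distrib)
        then have "\<xi> * (\<Theta> A h0 \<bullet> h) = Re (cinner (V h) z)" using \<xi> by auto
        then show ?thesis by (simp add: Re_cinner inner_commute)
      qed
      then show ?thesis using that by blast
    qed
    have "(z - V a) \<bullet> V h = 0" for h
      by (simp add: inner_diff_left a V_props(1))
    then have "z - V a = 0" by (rule perp)
    then show ?thesis by auto
  qed
  then have surj: "surj V" by (auto simp: surj_def)
  have "inj V"
  proof (rule injI)
    fix x y assume "V x = V y"
    then have "norm (V (x - y)) = 0" by (simp add: V.diff)
    then show "x = y" by (simp add: V_props(2))
  qed
  have VV: "V (inv V x) = x" for x using surj by (rule surj_f_inv_f)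
  have adj: "cadjoint V = inv V"
    by (rule cadjoint_eqI) (metis is_cadjoint_def V VV)
  show "unitary V"
    unfolding unitary_def adj using Vbl \<open>inj V\<close> surj by (simp add: surj_iff)
  show "\<Phi> A = (\<lambda>x. \<xi> *\<^sub>R V (\<Theta> A (cadjoint V x)))" if A: "A \<in> selfadjoint_ops"
  proof (rule selfadjoint_eqI[OF maps_selfadjoint[OF A]])
    have invV: "inv V (V x) = x" for x using \<open>inj V\<close> by (rule inv_f_f)
    have inv_cinner: "cinner (inv V x) (inv V y) = cinner x y" for x y
      using V[of "inv V x" "inv V y"] by (simp add: VV)
    note inv_props = semi_isometry[of "\<lambda>c. c" "inv V", OF disjI1[OF refl] inv_cinner]
    have "bounded_clinear (inv V)"
      by (rule bounded_clinear_intro[where K = 1]) (simp_all add: inv_props)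
    then have "bounded_clinear (\<lambda>x. V (\<Theta> A (inv V x)))"
      by (intro bounded_clinear_compose[OF Vbl] bounded_clinear_compose[OF selfadjoint_clinear[OF \<Theta>[OF A]]])
    moreover have "cinner (V (\<Theta> A (inv V x))) y = cinner x (V (\<Theta> A (inv V y)))" for x y
      using V[of "\<Theta> A (inv V x)" "inv V y"] V[of "inv V x" "\<Theta> A (inv V y)"]
      by (simp add: VV selfadjoint_cinner[OF \<Theta>[OF A]])
    ultimately have "(\<lambda>x. V (\<Theta> A (inv V x))) \<in> selfadjoint_ops" by (simp add: selfadjoint_ops_iff)
    then show "(\<lambda>x. \<xi> *\<^sub>R V (\<Theta> A (cadjoint V x))) \<in> selfadjoint_ops"
      unfolding adj by (rule selfadjoint_scaleR)
    fix x
    have "\<xi> *\<^sub>R V (\<Theta> A (inv V x)) \<bullet> x = \<xi> * (V (\<Theta> A (inv V x)) \<bullet> V (inv V x))" by (simp add: VV)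
    also have "\<dots> = \<Phi> A x \<bullet> x" by (simp only: V_props(1) form[OF A] \<xi>\<xi>) (simp only: VV)
    finally show "\<Phi> A x \<bullet> x = \<xi> *\<^sub>R V (\<Theta> A (cadjoint V x)) \<bullet> x" by (simp add: adj)
  qed
qed

theorem unitary_equivalence:
  assumes E: "orthonormal_basis E" and nontrivial: "\<exists>x :: 'a. norm x = 1"
  obtains \<xi> :: real and U where "\<xi> \<in> {-1, 1}" "\<xi> ^ (r + s + 1) = 1" "unitary U"
    "(\<forall>A\<in>selfadjoint_ops. \<Phi> A = (\<lambda>x. \<xi> *\<^sub>R U (A (cadjoint U x)))) \<or>
     (\<forall>A\<in>selfadjoint_ops. \<Phi> A = (\<lambda>x. \<xi> *\<^sub>R U (op_transpose E A (cadjoint U x))))"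
proof -
  obtain \<xi> :: real and Y where \<xi>: "\<xi> \<in> {-1, 1}" "\<xi> ^ (r + s + 1) = 1"
    and Y: "\<And>x y. cmod (cinner (Y x) (Y y)) = cmod (cinner x y)"
    and form: "\<And>A x. A \<in> selfadjoint_ops \<Longrightarrow> A x \<bullet> x = \<xi> * (\<Phi> A (Y x) \<bullet> Y x)"
    using form_preserving_map[OF nontrivial] by metis
  obtain W \<kappa> where \<kappa>: "\<kappa> = (\<lambda>c. c) \<or> \<kappa> = cnj" and W: "\<And>x y. cinner (W x) (W y) = \<kappa> (cinner x y)"
    and YW: "\<And>x. \<exists>c. cmod c = 1 \<and> Y x = c *\<^sub>C W x"
    using wigner[of Y] Y by metis
  have form_W: "A x \<bullet> x = \<xi> * (\<Phi> A (W x) \<bullet> W x)" if A: "A \<in> selfadjoint_ops" for A x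
  proof -
    obtain c where "cmod c = 1" "Y x = c *\<^sub>C W x" using YW by blast
    then show ?thesis
      using form[OF A, of x] selfadjoint_form_scaleC[OF maps_selfadjoint[OF A], of c "W x"] by simp
  qed
  from \<kappa> show thesis
  proof
    assume "\<kappa> = (\<lambda>c. c)"
    then have W': "cinner (W x) (W y) = cinner x y" for x y by (simp add: W)
    have "\<Phi> A = (\<lambda>x. \<xi> *\<^sub>R W (A (cadjoint W x)))" if A: "A \<in> selfadjoint_ops" for A
      by (rule unitary_if_form(2)[OF \<xi>(1) W' _ _ form_W A])
    moreover have "unitary W" by (rule unitary_if_form(1)[OF \<xi>(1) W' _ _ form_W])
    ultimately show thesis by (intro that[OF \<xi>] disjI1 ballI)
  next
    assume \<kappa>: "\<kappa> = cnj"
    obtain J where J: "\<And>x y. cinner (J x) (J y) = cnj (cinner x y)" "\<And>x. J (J x) = x"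
      and Je: "\<And>e. e \<in> E \<Longrightarrow> J e = e"
      using conjugation_exists[OF E] by metis
    define V where "V = (\<lambda>x. W (J x))"
    define \<Theta> where "\<Theta> = (\<lambda>(A :: 'a \<Rightarrow> 'a) x. J (A (J x)))"
    have V: "cinner (V x) (V y) = cinner x y" for x y by (simp add: V_def W \<kappa> J)
    have \<Theta>: "\<Theta> A \<in> selfadjoint_ops" if "A \<in> selfadjoint_ops" for A
      unfolding \<Theta>_def by (rule selfadjoint_conjugate[OF J that])
    have \<Theta>_zero: "A = (\<lambda>x. 0)" if "\<Theta> A = (\<lambda>x. 0)" for A
    proof
      fix x
      have "cinner (J (A x)) (J (A x)) = 0" using fun_cong[OF that, of "J x"] by (simp add: \<Theta>_def J(2))
      then have "cinner (A x) (A x) = 0" by (simp only: J(1) complex_cnj_zero_iff)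
      then show "A x = 0" by (simp add: cinner_self)
    qed
    have form_V: "\<Theta> A x \<bullet> x = \<xi> * (\<Phi> A (V x) \<bullet> V x)" if "A \<in> selfadjoint_ops" for A x
      unfolding \<Theta>_def V_def conjugate_form[OF J] by (rule form_W[OF that])
    have "\<Phi> A = (\<lambda>x. \<xi> *\<^sub>R V (op_transpose E A (cadjoint V x)))" if A: "A \<in> selfadjoint_ops" for A
    proof -
      have "op_transpose E A = \<Theta> A"
        unfolding \<Theta>_def by (rule op_transpose_eq_conjugate[OF J E Je A])
      then show ?thesis using unitary_if_form(2)[OF \<xi>(1) V \<Theta> \<Theta>_zero form_V A] by simp
    qed
    moreover have "unitary V" by (rule unitary_if_form(1)[OF \<xi>(1) V \<Theta> \<Theta>_zero form_V])
    ultimately show thesis by (intro that[OF \<xi>] disjI2 ballI)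
  qed
qed

end

section \<open>Reduction of generalized Jordan products\<close>

lemma op_prod_append: "op_prod (Ss @ Ts) = op_prod Ss \<circ> op_prod Ts"
  by (induction Ss) (simp_all add: op_prod_def comp_assoc)

lemma op_prod_replicate: "op_prod (replicate j B) = B ^^ j"
  by (induction j) (simp_all add: op_prod_def)

lemma gen_jordan_prod_two_factors:
  assumes p: "p < length js" and unique: "\<And>q. q < length js \<Longrightarrow> q \<noteq> p \<Longrightarrow> js ! p \<noteq> js ! q"
  shows "gen_jordan_prod js (\<lambda>i. if i = js ! p then A else B) = sandwich p (length js - 1 - p) A B"
proof -
  define T where "T = (\<lambda>i. if i = js ! p then A else B)"
  define s where "s = length js - 1 - p"
  have "map T js = replicate p B @ [A] @ replicate s B"
  proof (rule nth_equalityI)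
    show "length (map T js) = length (replicate p B @ [A] @ replicate s B)"
      using p by (simp add: s_def)
    fix q assume "q < length (map T js)"
    then show "map T js ! q = (replicate p B @ [A] @ replicate s B) ! q"
      using unique[of q] p by (auto simp: T_def s_def nth_append nth_Cons')
  qed
  moreover from this have "map T (rev js) = replicate s B @ [A] @ replicate p B"
    by (simp add: rev_map[symmetric])
  moreover have "op_prod [A] = A" by (simp add: op_prod_def)
  ultimately show ?thesis
    unfolding gen_jordan_prod_def T_def[symmetric] s_def[symmetric] sandwich_def
    by (simp add: op_prod_append op_prod_replicate del: append.simps)
qed

lemma sandwich_commute: "sandwich r s A B = sandwich s r A B"
  by (simp add: sandwich_def add.commute)

theorem theorem4p1:
  fixes \<Phi> :: "('a :: chilbert_space \<Rightarrow> 'a) \<Rightarrow> ('b :: chilbert_space \<Rightarrow> 'b)"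
    and k :: nat and "is" :: "nat list" and E :: "'a set"
  assumes "k \<ge> 2"
    and "set is = {1..k}"
    and "\<exists>p<length is. \<forall>q<length is. q \<noteq> p \<longrightarrow> is ! p \<noteq> is ! q"
    and "\<And>A. A \<in> selfadjoint_ops \<Longrightarrow> \<Phi> A \<in> selfadjoint_ops"
    and "\<And>A :: nat \<Rightarrow> 'a \<Rightarrow> 'a.
           (\<forall>i\<in>{1..k}. A i \<in> selfadjoint_ops) \<Longrightarrow> (\<exists>i\<in>{1..k}. op_rank (A i) \<le> 1) \<Longrightarrow>
           spectrum (gen_jordan_prod is (\<lambda>i. \<Phi> (A i))) = spectrum (gen_jordan_prod is A)"
    and "{B \<in> selfadjoint_ops. op_rank B \<le> 3} \<subseteq> \<Phi> ` selfadjoint_ops"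
    and "orthonormal_basis E"
  shows "\<exists>(\<xi> :: complex) (U :: 'a \<Rightarrow> 'b).
           \<xi> \<in> {-1, 1} \<and> \<xi> ^ length is = 1 \<and> unitary U \<and>
           ((\<forall>A\<in>selfadjoint_ops. \<Phi> A = (\<lambda>x. \<xi> *\<^sub>C U (A (cadjoint U x)))) \<or>
            (\<forall>A\<in>selfadjoint_ops. \<Phi> A = (\<lambda>x. \<xi> *\<^sub>C U (op_transpose E A (cadjoint U x)))))"
proof (cases "\<exists>x :: 'a. norm x = 1")
  \<comment> \<open>If \<open>H\<^sub>1 = 0\<close>, the range of \<open>\<Phi>\<close> is a single operator, so \<open>H\<^sub>2 = 0\<close> as well.\<close>
  case False
  have zero_a: "x = 0" for x :: 'a
  proof (rule ccontr)
    assume "x \<noteq> 0"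
    then have "norm (x /\<^sub>R norm x) = 1" by simp
    with False show False by blast
  qed
  have onto: "B \<in> {\<Phi> (\<lambda>x. 0)}" if "B \<in> selfadjoint_ops" "op_rank B \<le> 3" for B
  proof -
    have "B \<in> \<Phi> ` selfadjoint_ops" using subsetD[OF assms(6)] that by simp
    then obtain A where "B = \<Phi> A" by (rule imageE)
    moreover have "A = (\<lambda>x. 0)" by (rule ext) (rule zero_a)
    ultimately show ?thesis by simp
  qed
  have le: "(1 :: enat) \<le> 3" by (simp add: one_enat_def numeral_eq_enat)
  have zero_b: "y = 0" for y :: 'b
  proof -
    have "rank_one y = (\<lambda>x. 0)"
      using onto[OF selfadjoint_rank_one order_trans[OF op_rank_rank_one le], of y]
        onto[OF selfadjoint_zero order_trans[OF op_rank_zero le]] by simp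
    then have "rank_one y y \<bullet> y = 0" by simp
    then show ?thesis by (simp add: rank_one_form cinner_self)
  qed
  define U where "U = (\<lambda>x :: 'a. (0 :: 'b))"
  have eq_a: "x = x'" for x x' :: 'a by (rule trans[OF zero_a zero_a[symmetric]])
  have eq_b: "y = y'" for y y' :: 'b by (rule trans[OF zero_b zero_b[symmetric]])
  have "bounded_clinear U" by (simp add: U_def bounded_clinear_def)
  then have "unitary U" unfolding unitary_def by (intro conjI ext eq_a eq_b)
  moreover have "\<Phi> A = (\<lambda>x. 1 *\<^sub>C U (A (cadjoint U x)))" for A by (intro ext eq_b)
  ultimately show ?thesis by (intro exI[of _ 1] exI[of _ U] conjI disjI1 ballI) simp_all
next
  case nontrivial: True
  obtain p where p: "p < length is" and unique: "\<And>q. q < length is \<Longrightarrow> q \<noteq> p \<Longrightarrow> is ! p \<noteq> is ! q"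
    using assms(3) by blast
  define i0 where "i0 = is ! p"
  have i0: "i0 \<in> {1..k}" using p assms(2) nth_mem[of p "is"] by (simp add: i0_def)
  obtain i1 where i1: "i1 \<in> {1..k}" "i1 \<noteq> i0"
    using assms(1) by (cases "i0 = 1") (auto intro: that[of 1] that[of 2])
  have "card {1..k} \<le> length is" using card_length[of "is"] assms(2) by simp
  then have len: "length is \<ge> 2" using assms(1) by simp
  define q where "q = length is - 1 - p"
  \<comment> \<open>The larger exponent comes first, so that it is non-zero.\<close>
  define r where "r = max p q"
  define s where "s = min p q"
  have rs: "r + s + 1 = length is" using p by (simp add: r_def s_def q_def)
  have jordan: "gen_jordan_prod is (\<lambda>i. if i = i0 then A else B) = sandwich r s A B"
    for A B :: "'c :: chilbert_space \<Rightarrow> 'c"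
    using gen_jordan_prod_two_factors[OF p unique, of A B] sandwich_commute[of p q A B]
    unfolding i0_def q_def[symmetric] r_def s_def by (auto simp: max_def min_def)
  interpret spectrum_preserver \<Phi> r s
  proof
    show "1 \<le> r" using rs len by (auto simp: r_def s_def)
    show "\<Phi> A \<in> selfadjoint_ops" if "A \<in> selfadjoint_ops" for A using assms(4) that by blast
    show "D \<in> \<Phi> ` selfadjoint_ops" if "D \<in> selfadjoint_ops" "op_rank D \<le> 3" for D
      using assms(6) that by blast
    fix A B :: "'a \<Rightarrow> 'a"
    assume A: "A \<in> selfadjoint_ops" and B: "B \<in> selfadjoint_ops" and rank: "op_rank A \<le> 1 \<or> op_rank B \<le> 1"
    have "\<exists>i\<in>{1..k}. op_rank (if i = i0 then A else B) \<le> 1" using rank i0 i1 by auto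
    then have "spectrum (gen_jordan_prod is (\<lambda>i. \<Phi> (if i = i0 then A else B)))
        = spectrum (gen_jordan_prod is (\<lambda>i. if i = i0 then A else B))"
      using A B by (intro assms(5)) auto
    then show "spectrum (sandwich r s (\<Phi> A) (\<Phi> B)) = spectrum (sandwich r s A B)"
      by (simp only: if_distrib[of \<Phi>] jordan)
  qed
  obtain \<xi> :: real and U where \<xi>: "\<xi> \<in> {-1, 1}" "\<xi> ^ (r + s + 1) = 1" and U: "unitary U"
    and \<Phi>U: "(\<forall>A\<in>selfadjoint_ops. \<Phi> A = (\<lambda>x. \<xi> *\<^sub>R U (A (cadjoint U x)))) \<or>
     (\<forall>A\<in>selfadjoint_ops. \<Phi> A = (\<lambda>x. \<xi> *\<^sub>R U (op_transpose E A (cadjoint U x))))"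
    using unitary_equivalence[OF assms(7) nontrivial] by metis
  have "complex_of_real \<xi> \<in> {-1, 1}" "complex_of_real \<xi> ^ length is = 1"
    using \<xi> by (auto simp flip: rs of_real_power)
  then show ?thesis
    using U \<Phi>U unfolding scaleC_of_real[symmetric] by blast
qed

end
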